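(* Let $p,n\in\mathbb N$ with $p\ge n\ge 10$, and write $p=k(n-1)+r$ with $k\in\mathbb N$ and $r\in\{0,1,\ldots,n-2\}$. Then $$\mathrm{ex}(p;T_n'')=\frac{(n-2)p-r(n-1-r)}2+\max\Big\{0,\Big\lfloor\frac{r(n-4-r)-3(n-1)}2\Big\rfloor\Big\}.$$
   Context: All graphs are finite simple graphs. For a graph $L$, $\mathrm{ex}(p;L)$ denotes the maximum number of edges in a graph on $p$ vertices that contains no subgraph isomorphic to $L$. For $n\ge 6$, $T_n''$ is the tree on vertex set $\{v_0,\ldots,v_{n-1}\}$ with edge set $\{v_0v_1,v_0v_2,\ldots,v_0v_{n-4},\ v_1v_{n-3},\ v_1v_{n-2},\ v_2v_{n-1}\}$. $\lfloor x\rfloor$ is the greatest integer not exceeding $x$; $\mathbb N=\{1,2,\ldots\}$. *)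

theory Defs
  imports Complex_Main
begin

definition simple_graph :: "'a set \<Rightarrow> 'a set set \<Rightarrow> bool" where
  "simple_graph V E \<longleftrightarrow> finite V \<and> (\<forall>e\<in>E. \<exists>u v. u \<in> V \<and> v \<in> V \<and> u \<noteq> v \<and> e = {u, v})"

definition contains_copy :: "'a set \<Rightarrow> 'a set set \<Rightarrow> 'b set \<Rightarrow> 'b set set \<Rightarrow> bool" where
  "contains_copy V E VL EL \<longleftrightarrow>
     (\<exists>f. inj_on f VL \<and> f ` VL \<subseteq> V \<and> (\<forall>e\<in>EL. f ` e \<in> E))"

definition ex :: "nat \<Rightarrow> 'b set \<Rightarrow> 'b set set \<Rightarrow> nat" where
  "ex p VL EL = Max {card E | E. simple_graph {0..<p} E \<and> \<not> contains_copy {0..<p} E VL EL}"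

definition Tpp_V :: "nat \<Rightarrow> nat set" where
  "Tpp_V n = {0..<n}"

definition Tpp_E :: "nat \<Rightarrow> nat set set" where
  "Tpp_E n = {{0, i} | i. 1 \<le> i \<and> i \<le> n - 4} \<union> {{1, n - 3}, {1, n - 2}, {2, n - 1}}"

end

theory Submission
  imports Defs
begin

text \<open>Put \<open>m = n - 1\<close>. The upper bound is by induction on the number of vertices. If all degrees are at
  most \<open>m - 4\<close>, the degree sum suffices. Otherwise let \<open>v\<close> have maximum degree \<open>d \<ge> m - 3\<close>. Since \<open>v\<close> is
  not the centre of a copy of the tree, few edges leave its closed neighbourhood \<open>S\<close>, or few edges
  meet \<open>S\<close> at all, and \<open>S\<close>, possibly enlarged by one or two vertices to have exactly \<open>m\<close> elements,
  meets at most as many edges as a disjoint union of cliques \<open>K\<^sub>m\<close> and one smaller clique on the same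
  number of vertices. Such a set can be deleted. For the lower bound, take \<open>k K\<^sub>m \<union> K\<^sub>r\<close>, or
  \<open>(k - 1) K\<^sub>m\<close> together with a graph on \<open>m + r\<close> vertices that is \<open>(m - 4)\<close>-regular up to parity.\<close>

section \<open>Superadditivity of the bound\<close>

text \<open>The centre of the tree has degree \<open>n - 4 = m - 3\<close>. This explains the number
  \<open>m - 4\<close>: maximum degree \<open>m - 4\<close> excludes the tree, which gives both the
  second extremal graph and the case of the induction that deletes nothing. A deleted set of
  \<open>w \<le> m\<close> vertices may meet at most as many edges as \<open>K_w\<close> has. This
  quota is quadratic in \<open>w\<close>: the last vertex that fills a set up to \<open>m\<close>
  elements raises it by \<open>m - 1\<close>, while each added vertex costs at most the maximum
  degree. Hence stars with fewer than \<open>m\<close> vertices are worth enlarging. The obstacle is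
  that the bound is the larger of two functions that depend on \<open>p mod m\<close>, so it is not
  evident that it survives putting the deleted part back; the arithmetic of
  \<open>bounded_by\<close> settles this. The hypothesis \<open>n \<ge> 10\<close>, that is
  \<open>m \<ge> 9\<close>, is where the quadratic quota overtakes the linear estimates of the edges
  met: \<open>6 * m + 18 \<le> m * (m - 1)\<close> is an equality at \<open>m = 9\<close>.\<close>

text \<open>The argument \<open>t\<close> is twice a number of edges. The two alternatives are the sizes of the
  extremal graphs \<open>k K\<^sub>m \<union> K\<^sub>r\<close> and \<open>(k - 1) K\<^sub>m \<union> G\<close> with \<open>G\<close> an \<open>(m - 4)\<close>-regular graph on
  \<open>m + r\<close> vertices, where \<open>m = n - 1\<close>.\<close>

definition bounded_by :: "nat \<Rightarrow> nat \<Rightarrow> nat \<Rightarrow> bool" where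
  "bounded_by m p t \<longleftrightarrow> (\<exists>k r. p = k * m + r \<and> r < m \<and>
     (t \<le> k * (m * (m - 1)) + r * (r - 1) \<or>
      1 \<le> k \<and> t \<le> (k - 1) * (m * (m - 1)) + (m - 4) * (m + r)))"

lemma bounded_byI:
  assumes "p = k * m + r" "r < m"
    and "t \<le> k * (m * (m - 1)) + r * (r - 1) \<or>
      1 \<le> k \<and> t \<le> (k - 1) * (m * (m - 1)) + (m - 4) * (m + r)"
  shows "bounded_by m p t"
  unfolding bounded_by_def using assms by blast

lemma bounded_by_mono:
  assumes "bounded_by m p t" "s \<le> t" shows "bounded_by m p s"
proof -
  obtain k r where "p = k * m + r" "r < m"
    and "t \<le> k * (m * (m - 1)) + r * (r - 1) \<or>
      1 \<le> k \<and> t \<le> (k - 1) * (m * (m - 1)) + (m - 4) * (m + r)"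
    using assms(1) unfolding bounded_by_def by blast
  then show ?thesis using assms(2) le_trans by (intro bounded_byI[of p k m r]) auto
qed

lemma bounded_by_add_full:
  assumes "bounded_by m p t"
  shows "bounded_by m (j * m + p) (j * (m * (m - 1)) + t)"
proof -
  obtain k r where kr: "p = k * m + r" "r < m"
    and d: "t \<le> k * (m * (m - 1)) + r * (r - 1) \<or>
      1 \<le> k \<and> t \<le> (k - 1) * (m * (m - 1)) + (m - 4) * (m + r)"
    using assms unfolding bounded_by_def by blast
  have "j * m + p = (j + k) * m + r" using kr by (simp add: algebra_simps)
  moreover have "j * (m * (m - 1)) + t \<le> (j + k) * (m * (m - 1)) + r * (r - 1) \<or>
      1 \<le> j + k \<and> j * (m * (m - 1)) + t \<le> (j + k - 1) * (m * (m - 1)) + (m - 4) * (m + r)"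
    using d
  proof
    assume a: "1 \<le> k \<and> t \<le> (k - 1) * (m * (m - 1)) + (m - 4) * (m + r)"
    then have "j + k - 1 = j + (k - 1)" by simp
    then show ?thesis using a by (simp only: add_mult_distrib) simp
  qed (simp add: add_mult_distrib)
  ultimately show ?thesis using kr(2) by (intro bounded_byI[of _ "j + k" m r])
qed

text \<open>Two disjoint cliques are part of one clique on all their vertices.\<close>

lemma pronic_add_le: "r * (r - 1) + w * (w - 1) \<le> (r + w) * (r + w - (1::nat))"
proof (cases "r = 0 \<or> w = 0")
  case False
  then obtain a b where "r = Suc a" "w = Suc b" by (metis not0_implies_Suc)
  then show ?thesis by (simp add: algebra_simps)
qed auto

text \<open>Convexity: shifting vertices from one clique to the other until the larger has
  \<open>m\<close> of them gains \<open>2 * (m - r) * (m - w)\<close>.\<close>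

lemma pronic_carry_le:
  fixes r w m :: nat
  assumes "r \<le> m" "w \<le> m" "m \<le> r + w"
  shows "r * (r - 1) + w * (w - 1) \<le> m * (m - 1) + (r + w - m) * (r + w - m - 1)"
proof -
  have pr: "int (a * (a - 1)) = int a * int a - int a" for a :: nat
    by (cases a) (auto simp: algebra_simps)
  have "0 \<le> (int m - int r) * (int m - int w)"
    using assms by (intro mult_nonneg_nonneg) auto
  moreover have "int (r + w - m) = int r + int w - int m" using assms by auto
  ultimately have "int (r * (r - 1) + w * (w - 1))
      \<le> int (m * (m - 1) + (r + w - m) * (r + w - m - 1))"
    unfolding of_nat_add pr by (simp add: algebra_simps)
  then show ?thesis by (simp only: zle_int)
qed

text \<open>At remainder \<open>r \<le> 1\<close> the clique alternative is at least as large as the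
  regular one, so \<open>bounded_by_add_part\<close> can switch to it when
  \<open>w \<ge> m - 2\<close> makes the degree \<open>w - 1\<close> exceed
  \<open>m - 4\<close>.\<close>

lemma regular_below_complete:
  fixes m r :: nat
  assumes "4 \<le> m" "r \<le> 1"
  shows "(m - 4) * (m + r) \<le> m * (m - 1)"
proof -
  obtain a where a: "m = a + 4" using assms(1) by (metis add.commute le_Suc_ex)
  have "(m - 4) * (m + r) \<le> (m - 4) * (m + 1)"
    by (rule mult_le_mono2) (use assms in simp)
  also have "\<dots> \<le> m * (m - 1)"
    unfolding a by (simp add: algebra_simps)
  finally show ?thesis .
qed

text \<open>A \<open>K_w\<close> is absorbed without leaving the two alternatives. Next to cliques
  it merges with \<open>K_r\<close> or completes a further \<open>K_m\<close>. Next to a regular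
  part it either has degree at most \<open>m - 4\<close> and joins that part, or is completed to a
  \<open>K_m\<close> by vertices of that part, or \<open>r \<le> 1\<close>.\<close>

lemma bounded_by_add_part:
  assumes b: "bounded_by m p t" and w: "w \<le> m" and m: "4 \<le> m"
  shows "bounded_by m (p + w) (t + w * (w - 1))"
proof -
  obtain k r where kr: "p = k * m + r" "r < m"
    and d: "t \<le> k * (m * (m - 1)) + r * (r - 1) \<or>
      1 \<le> k \<and> t \<le> (k - 1) * (m * (m - 1)) + (m - 4) * (m + r)"
    using b unfolding bounded_by_def by blast
  have clique: ?thesis if t: "t \<le> k * (m * (m - 1)) + r * (r - 1)"
  proof (cases "r + w < m")
    case True
    have "p + w = k * m + (r + w)" using kr by simp
    moreover have "t + w * (w - 1) \<le> k * (m * (m - 1)) + (r + w) * (r + w - 1)"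
      using t pronic_add_le[of r w] by linarith
    ultimately show ?thesis unfolding bounded_by_def using True by blast
  next
    case False
    have "p + w = (k + 1) * m + (r + w - m)" using kr False by simp
    moreover have "t + w * (w - 1) \<le> (k + 1) * (m * (m - 1)) + (r + w - m) * (r + w - m - 1)"
      using t pronic_carry_le[of r m w] kr(2) w False by (simp add: add_mult_distrib)
    moreover have "r + w - m < m" using kr(2) w by linarith
    ultimately show ?thesis unfolding bounded_by_def by blast
  qed
  show ?thesis using d
  proof
    assume "1 \<le> k \<and> t \<le> (k - 1) * (m * (m - 1)) + (m - 4) * (m + r)"
    then have k: "1 \<le> k" and t: "t \<le> (k - 1) * (m * (m - 1)) + (m - 4) * (m + r)" by auto
    have kk: "k * (m * (m - 1)) = (k - 1) * (m * (m - 1)) + m * (m - 1)"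
      using k by (cases k) auto
    consider "r + w < m" "w + 3 \<le> m" | "r + w < m" "r \<le> 1" | "m \<le> r + w" by linarith
    then show ?thesis
    proof cases
      case 1
      have "w - 1 \<le> m - 4" using 1 by linarith
      then have "w * (w - 1) \<le> (m - 4) * w" by (simp add: mult.commute)
      then have "t + w * (w - 1) \<le> (k - 1) * (m * (m - 1)) + (m - 4) * (m + (r + w))"
        using t by (simp only: distrib_left)
      moreover have "p + w = k * m + (r + w)" using kr by simp
      ultimately show ?thesis unfolding bounded_by_def using 1 k by blast
    next
      case 2
      have "t \<le> k * (m * (m - 1)) + r * (r - 1)"
        using t kk regular_below_complete[OF m 2(2)] by linarith
      then show ?thesis by (rule clique)
    next
      case 3
      obtain a where a: "m = a + 4" using m by (metis add.commute le_Suc_ex)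
      obtain b where b: "r + w = m + b" using 3 by (metis le_Suc_ex)
      obtain c where c: "m = w + c" using w by (metis le_Suc_ex)
      have r: "r = b + c" using b c by simp
      \<comment> \<open>The \<open>c = m - w\<close> vertices taken out of the regular part complete
        \<open>K_w\<close> to a \<open>K_m\<close>; their degree grows from \<open>m - 4\<close> to
        \<open>m - 1\<close>.\<close>
      have "(m - 4) * r + w * (w - 1) \<le> m * (m - 1) + (m - 4) * b"
      proof -
        have "(m - 4) * c \<le> (m - 1) * c" by (intro mult_le_mono1 diff_le_mono2) simp
        moreover have "w * (w - 1) \<le> w * (m - 1)" by (intro mult_le_mono2 diff_le_mono w)
        moreover have "m * (m - 1) = w * (m - 1) + (m - 1) * c"
          using c by (metis add_mult_distrib mult.commute)
        moreover have "(m - 4) * r = (m - 4) * b + (m - 4) * c"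
          by (simp only: r distrib_left)
        ultimately show ?thesis by linarith
      qed
      then have "t + w * (w - 1) \<le> k * (m * (m - 1)) + (m - 4) * (m + b)"
        using t kk by (simp add: distrib_left)
      moreover have "p + w = (k + 1) * m + b" using kr b by simp
      moreover have "b < m" using b kr w by linarith
      ultimately show ?thesis by (intro bounded_byI[of _ "k + 1" m b]) simp_all
    qed
  qed (rule clique)
qed

lemma bounded_by_small:
  assumes "p < m" shows "bounded_by m p (p * (p - 1))"
  by (rule bounded_byI[of _ 0 _ p]) (use assms in auto)

text \<open>Trading all but \<open>m + r\<close> vertices of an \<open>(m - 4)\<close>-regular graph
  for copies of \<open>K_m\<close> can only raise the degree sum.\<close>

lemma bounded_by_regular:
  assumes "0 < m" "m \<le> p"
  shows "bounded_by m p ((m - 4) * p)"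
proof -
  define k r where "k = p div m" and "r = p mod m"
  have p: "p = k * m + r" "r < m" using assms by (auto simp: k_def r_def)
  have k: "1 \<le> k" using assms p by (cases k) auto
  then obtain l where l: "k = Suc l" by (metis Suc_le_D One_nat_def)
  have "p = l * m + (m + r)" using p l by simp
  then have "(m - 4) * p = l * (m * (m - 4)) + (m - 4) * (m + r)"
    by (simp only: distrib_left[of "m - 4" "l * m"] mult.left_commute mult.commute)
  also have "\<dots> \<le> l * (m * (m - 1)) + (m - 4) * (m + r)"
    by (intro add_le_mono1 mult_le_mono2 diff_le_mono2) simp
  finally show ?thesis using p k l
    by (intro bounded_byI[of p k m r]) auto
qed

section \<open>Edges meeting a vertex set\<close>

locale sgraph =
  fixes V :: "'a set" and E :: "'a set set"
  assumes sg: "simple_graph V E"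
begin

text \<open>Total on the type: elements outside \<open>V\<close> have no neighbours, so bounds on
  degrees can be stated for all elements.\<close>

definition nb :: "'a \<Rightarrow> 'a set" where "nb u = {w. {u, w} \<in> E}"

text \<open>The number of edges lost by deleting \<open>S\<close>.\<close>

definition inc :: "'a set \<Rightarrow> nat" where "inc S = card {e \<in> E. e \<inter> S \<noteq> {}}"

abbreviation deg :: "'a \<Rightarrow> nat" where "deg u \<equiv> card (nb u)"

abbreviation out :: "'a set \<Rightarrow> 'a \<Rightarrow> nat" where "out S u \<equiv> card (nb u - S)"

lemma finite_V [simp]: "finite V"
  using sg by (simp add: simple_graph_def)

lemma edge_elim: "e \<in> E \<Longrightarrow> \<exists>u v. u \<in> V \<and> v \<in> V \<and> u \<noteq> v \<and> e = {u, v}"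
  using sg by (simp add: simple_graph_def)

lemma finite_E [simp]: "finite E"
proof (rule finite_subset)
  show "E \<subseteq> Pow V" using edge_elim by fastforce
qed simp

lemma nb_subset: "nb u \<subseteq> V - {u}"
  unfolding nb_def using edge_elim by (fastforce simp: doubleton_eq_iff)

lemma nb_irrefl [simp]: "u \<notin> nb u" using nb_subset by blast

lemma finite_nb [simp]: "finite (nb u)"
  using nb_subset finite_V by (meson finite_Diff finite_subset)

lemma nb_sym: "w \<in> nb u \<longleftrightarrow> u \<in> nb w"
  by (simp add: nb_def insert_commute)

lemma nb_in_V: "w \<in> nb u \<Longrightarrow> w \<in> V \<and> u \<in> V"
  using nb_subset nb_sym by blast

lemma deg_split: "deg u = card (nb u \<inter> S) + out S u"
  by (metis Int_Diff_Un Int_Diff_disjoint card_Un_disjoint finite_Diff finite_Int finite_nb)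

lemma inc_empty [simp]: "inc {} = 0" by (simp add: inc_def)

lemma inc_insert:
  assumes "v \<notin> S"
  shows "inc (insert v S) = inc S + out S v"
proof -
  have eq: "{e \<in> E. e \<inter> insert v S \<noteq> {}} = {e \<in> E. e \<inter> S \<noteq> {}} \<union> (\<lambda>u. {v, u}) ` (nb v - S)"
  proof (intro equalityI subsetI)
    fix e assume "e \<in> {e \<in> E. e \<inter> insert v S \<noteq> {}}"
    then have e: "e \<in> E" "e \<inter> insert v S \<noteq> {}" by auto
    show "e \<in> {e \<in> E. e \<inter> S \<noteq> {}} \<union> (\<lambda>u. {v, u}) ` (nb v - S)"
    proof (cases "e \<inter> S = {}")
      case True
      then have "v \<in> e" using e by auto
      then obtain u where "e = {v, u}" using edge_elim[OF e(1)] by blast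
      then show ?thesis using True e(1) by (auto simp: nb_def)
    qed (use e in auto)
  qed (auto simp: nb_def)
  have "inj_on (\<lambda>u. {v, u}) (nb v - S)" by (auto simp: inj_on_def doubleton_eq_iff)
  moreover have "{e \<in> E. e \<inter> S \<noteq> {}} \<inter> (\<lambda>u. {v, u}) ` (nb v - S) = {}" using assms by auto
  ultimately show ?thesis unfolding inc_def eq
    by (subst card_Un_disjoint) (auto simp: card_image)
qed

text \<open>An edge inside \<open>S\<close> is seen by the degrees of both ends; an edge leaving
  \<open>S\<close> is seen twice by its one end in \<open>S\<close>, in \<open>deg\<close> and in
  \<open>out\<close>.\<close>

lemma inc_double: "finite S \<Longrightarrow> 2 * inc S = (\<Sum>u\<in>S. deg u + out S u)"
proof (induction S rule: finite_induct)
  case (insert v S)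
  have 1: "out S u = out (insert v S) u + (if u \<in> nb v then 1 else 0)" if "u \<in> S" for u
  proof (cases "v \<in> nb u")
    case True
    have e: "nb u - insert v S = (nb u - S) - {v}" by blast
    have "card (nb u - S) = Suc (card ((nb u - S) - {v}))"
      by (rule card.remove) (use True insert in simp_all)
    moreover have "u \<in> nb v" using True nb_sym by blast
    ultimately show ?thesis unfolding e by (simp only: if_True)
  next
    case False
    then have e: "nb u - insert v S = nb u - S" by blast
    have "u \<notin> nb v" using False nb_sym by blast
    then show ?thesis unfolding e by simp
  qed
  have "(\<Sum>u\<in>S. deg u + out S u) = (\<Sum>u\<in>S. deg u + out (insert v S) u) + card (nb v \<inter> S)"
  proof -
    have "(\<Sum>u\<in>S. deg u + out S u)
        = (\<Sum>u\<in>S. (deg u + out (insert v S) u) + (if u \<in> nb v then 1 else 0))"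
      by (intro sum.cong refl) (simp add: 1)
    also have "\<dots> = (\<Sum>u\<in>S. deg u + out (insert v S) u) + (\<Sum>u\<in>S. if u \<in> nb v then 1 else 0)"
      by (rule sum.distrib)
    also have "(\<Sum>u\<in>S. if u \<in> nb v then 1 else (0::nat)) = card (nb v \<inter> S)"
      using insert(1) by (simp add: sum.If_cases Int_commute)
    finally show ?thesis .
  qed
  moreover have e: "nb v - insert v S = nb v - S" by auto
  moreover have "(\<Sum>u\<in>insert v S. deg u + out (insert v S) u)
      = (deg v + out (insert v S) v) + (\<Sum>u\<in>S. deg u + out (insert v S) u)"
    using insert by simp
  ultimately show ?case using insert.IH inc_insert[OF insert.hyps(2)] deg_split[of v S] unfolding e by linarith
qed simp

lemma inc_Un_le:
  assumes "finite X" "S \<inter> X = {}"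
  shows "inc (S \<union> X) \<le> inc S + (\<Sum>x\<in>X. out S x)"
  using assms
proof (induction X rule: finite_induct)
  case (insert x X)
  have "inc (S \<union> insert x X) = inc (S \<union> X) + out (S \<union> X) x"
    using inc_insert[of x "S \<union> X"] insert by simp
  moreover have "out (S \<union> X) x \<le> out S x" by (intro card_mono) auto
  ultimately show ?case using insert by simp
qed simp

lemma sum_cut_swap:
  assumes "finite S" "finite X"
  shows "(\<Sum>x\<in>X. card (nb x \<inter> S)) = (\<Sum>u\<in>S. card (nb u \<inter> X))"
proof -
  have "card (nb x \<inter> S) = (\<Sum>u\<in>S. if {x, u} \<in> E then 1 else 0)" if "finite S" for x S
    using that by (simp add: sum.If_cases nb_def Int_commute Collect_conj_eq)
  then show ?thesis using assms
    by (simp add: sum.swap[of _ S X] insert_commute)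
qed

lemma card_E_remove: "card E = card {e \<in> E. e \<inter> S = {}} + inc S"
proof -
  have "E = {e \<in> E. e \<inter> S = {}} \<union> {e \<in> E. e \<inter> S \<noteq> {}}" by auto
  then show ?thesis unfolding inc_def
    by (subst (1) \<open>E = _\<close>, intro card_Un_disjoint) auto
qed

lemma card_E_eq_inc: "card E = inc V"
proof -
  have "{e \<in> E. e \<inter> V = {}} = {}" using edge_elim by fastforce
  then show ?thesis using card_E_remove[of V] by simp
qed

lemma handshake: "2 * card E = (\<Sum>u\<in>V. deg u)"
proof -
  have o: "nb u - V = {}" for u using nb_subset by blast
  have "2 * inc V = (\<Sum>u\<in>V. deg u + out V u)" by (rule inc_double) simp
  then show ?thesis unfolding o card_E_eq_inc by simp
qed

end

section \<open>Removable sets around a vertex of large degree\<close>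

lemma two_elements:
  assumes "2 \<le> card A"
  obtains x y where "x \<in> A" "y \<in> A" "x \<noteq> y"
proof -
  have "finite A" using assms card.infinite by fastforce
  then show ?thesis using assms that card_le_Suc0_iff_eq[of A] by fastforce
qed

lemma sum_le_card_mult:
  fixes f :: "'b \<Rightarrow> nat"
  assumes "\<And>x. x \<in> A \<Longrightarrow> f x \<le> c"
  shows "sum f A \<le> card A * c"
  using sum_bounded_above[of A f c] assms by simp

text \<open>The tree \<open>T\<^sub>n''\<close> centred at \<open>v\<close>, with \<open>u\<close> carrying the leaves \<open>x\<close>, \<open>y\<close> and \<open>w\<close> carrying the leaf \<open>z\<close>,
  needs \<open>n - 6 = m - 5\<close> further neighbours of \<open>v\<close>.\<close>

locale spider_free = sgraph +
  fixes m :: nat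
  assumes m_ge: "9 \<le> m"
    and no_spider: "\<lbrakk>u \<in> nb v; w \<in> nb v; x \<in> nb u; y \<in> nb u; z \<in> nb w; distinct [v, u, w, x, y, z]\<rbrakk>
      \<Longrightarrow> card (nb v - {u, w, x, y, z}) + 5 < m"
begin

text \<open>Each of \<open>x\<close>, \<open>y\<close>, \<open>z\<close> that is adjacent to
  \<open>v\<close> uses up one of the further leaves. So such a configuration cannot occur if
  \<open>deg v \<ge> m\<close>; for \<open>deg v = m - 1\<close>, \<open>m - 2\<close>,
  \<open>m - 3\<close> at least three, two, one of \<open>x\<close>, \<open>y\<close>,
  \<open>z\<close> must be adjacent to \<open>v\<close>.\<close>

lemma no_spider_count:
  assumes "u \<in> nb v" "w \<in> nb v" "x \<in> nb u" "y \<in> nb u" "z \<in> nb w" "distinct [v, u, w, x, y, z]"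
  shows "deg v + 3 < m + card (nb v \<inter> {x, y, z})"
proof -
  have "nb v \<inter> {u, w, x, y, z} = {u, w} \<union> (nb v \<inter> {x, y, z})" using assms by auto
  also have "card \<dots> = card {u, w} + card (nb v \<inter> {x, y, z})"
    by (rule card_Un_disjoint) (use assms(6) in auto)
  also have "card {u, w} = 2" using assms(6) by simp
  finally show ?thesis
    using no_spider[OF assms] deg_split[of v "{u, w, x, y, z}"] by linarith
qed

text \<open>Deleting such an \<open>S\<close> costs no more edges than deleting \<open>j\<close> copies of \<open>K\<^sub>m\<close> and a \<open>K\<^sub>w\<close>, which
  the bound \<open>bounded_by\<close> can afford.\<close>

definition reducible :: bool where
  "reducible \<longleftrightarrow> (\<exists>S j w. S \<subseteq> V \<and> S \<noteq> {} \<and> card S = j * m + w \<and> w \<le> m \<and>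
     2 * inc S \<le> j * (m * (m - 1)) + w * (w - 1))"

lemma reducibleI:
  assumes "S \<subseteq> V" "S \<noteq> {}" "card S \<le> m" "2 * inc S \<le> card S * (card S - 1)"
  shows reducible
  unfolding reducible_def using assms by (intro exI[of _ S] exI[of _ 0] exI[of _ "card S"]) simp

abbreviation star :: "'a \<Rightarrow> 'a set" where "star v \<equiv> insert v (nb v)"

lemma finite_star: "finite (star v)" by simp

lemma card_star: "card (star v) = Suc (deg v)" by simp

lemma star_subset: "v \<in> V \<Longrightarrow> star v \<subseteq> V" using nb_in_V by blast

lemma inc_star:
  "2 * inc (star v) = deg v + (\<Sum>u\<in>nb v. deg u + out (star v) u)"
proof -
  have e: "nb v - star v = {}" by blast
  have "2 * inc (star v) = (\<Sum>u\<in>star v. deg u + out (star v) u)" by (rule inc_double) simp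
  also have "\<dots> = (deg v + out (star v) v) + (\<Sum>u\<in>nb v. deg u + out (star v) u)"
    by (rule sum.insert) simp_all
  finally show ?thesis unfolding e by simp
qed

lemma inc_star_le: "inc (star v) \<le> deg v + (\<Sum>u\<in>nb v. card (nb u - {v}))"
proof -
  have "inc {v} = deg v" using inc_insert[of v "{}"] by simp
  then show ?thesis using inc_Un_le[of "nb v" "{v}"] by simp
qed

text \<open>If some \<open>u\<close> has three neighbours besides \<open>v\<close>, two of them
  usually remain as leaves whatever \<open>w\<close> and \<open>z\<close> are, and that is forbidden
  at this degree. With exactly three, at most three other neighbours of \<open>v\<close> contribute,
  at most 3 each, for a total of at most \<open>12\<close>. With four or more, every other
  \<open>w\<close> is adjacent to at most \<open>u\<close> and \<open>v\<close>.\<close>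

lemma star_contribution:
  assumes v: "v \<in> V" and d: "m \<le> deg v" and mx: "\<And>u. deg u \<le> deg v"
  shows "(\<Sum>u\<in>nb v. card (nb u - {v})) \<le> 2 * deg v"
proof (cases "\<forall>u\<in>nb v. card (nb u - {v}) \<le> 2")
  case True
  then show ?thesis using sum_le_card_mult[of "nb v" "\<lambda>u. card (nb u - {v})" 2] by simp
next
  case False
  then obtain u where u: "u \<in> nb v" and u3: "3 \<le> card (nb u - {v})" by force
  define A where "A w = nb w - {v}" for w
  have fA [simp]: "finite (A w)" for w by (simp add: A_def)
  have vu: "v \<in> nb u" using u nb_sym by blast
  have key: False if w: "w \<in> nb v" "w \<noteq> u" "z \<in> A w" "z \<noteq> u" and c: "2 \<le> card (A u - {w, z})" for w z
  proof -
    obtain x y where xy: "x \<in> A u - {w, z}" "y \<in> A u - {w, z}" "x \<noteq> y"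
      using two_elements[OF c] by blast
    have "distinct [v, u, w, x, y, z]" using u w xy by (auto simp: A_def)
    then have "deg v + 3 < m + card (nb v \<inter> {x, y, z})"
      using u w xy by (intro no_spider_count[of u v w x y z]) (auto simp: A_def)
    moreover have "card (nb v \<inter> {x, y, z}) \<le> card {x, y, z}" by (rule card_mono) auto
    moreover have "card {x, y, z} \<le> 3" by (simp add: card_insert_if)
    ultimately show False using d by linarith
  qed
  have rest: "(\<Sum>w\<in>nb v. card (A w)) = card (A u) + (\<Sum>w\<in>nb v - {u}. card (A w))"
    by (rule sum.remove) (use u in simp_all)
  have dl: "card (A u) - card X \<le> card (A u - X)" if "finite X" for X
    using diff_card_le_card_Diff[OF that] .
  have "(\<Sum>w\<in>nb v. card (A w)) \<le> 2 * deg v"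
  proof (cases "card (A u) = 3")
    case True
    have A0: "A w = {}" if w: "w \<in> nb v - {u}" "w \<notin> A u" for w
    proof (rule ccontr)
      assume "A w \<noteq> {}"
      then obtain z where z: "z \<in> A w" by blast
      have "z \<noteq> u" using z w nb_sym[of u w] by (auto simp: A_def)
      moreover have "A u - {w, z} = A u - {z}" using w by blast
      then have "2 \<le> card (A u - {w, z})" using dl[of "{z}"] True by simp
      ultimately show False using key[of w z] w z by blast
    qed
    have A3: "card (A w) \<le> 3" if w: "w \<in> nb v - {u}" "w \<in> A u" for w
    proof -
      have "A w \<subseteq> insert u (A u - {w})"
      proof (rule subsetI, rule ccontr)
        fix z assume z: "z \<in> A w" "z \<notin> insert u (A u - {w})"
        have "z \<noteq> w" using z by (auto simp: A_def)
        then have "A u - {w, z} = A u - {w}" using z by blast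
        then have "2 \<le> card (A u - {w, z})" using dl[of "{w}"] True by simp
        then show False using key[of w z] w z by blast
      qed
      then have "card (A w) \<le> card (insert u (A u - {w}))" by (intro card_mono) auto
      also have "\<dots> \<le> Suc (card (A u - {w}))" by (rule card_insert_le_m1) auto
      also have "card (A u - {w}) = 2" using w(2) True by simp
      finally show ?thesis by simp
    qed
    have "(\<Sum>w\<in>nb v - {u}. card (A w)) = (\<Sum>w\<in>(nb v - {u}) \<inter> A u. card (A w))"
      by (rule sum.mono_neutral_right) (use A0 in auto)
    also have "\<dots> \<le> card ((nb v - {u}) \<inter> A u) * 3"
      by (rule sum_le_card_mult) (use A3 in auto)
    also have "card ((nb v - {u}) \<inter> A u) \<le> card (A u)" by (rule card_mono) auto
    finally show ?thesis using rest True d m_ge by linarith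
  next
    case False
    then have u4: "4 \<le> card (A u)" using u3 by (simp add: A_def)
    have A1: "card (A w) \<le> 1" if w: "w \<in> nb v - {u}" for w
    proof -
      have "A w \<subseteq> {u}"
      proof (rule subsetI, rule ccontr)
        fix z assume z: "z \<in> A w" "z \<notin> {u}"
        have "card {w, z} \<le> 2" by (simp add: card_insert_if)
        then have "2 \<le> card (A u - {w, z})" using dl[of "{w, z}"] u4 by simp
        then show False using key[of w z] w z by blast
      qed
      then show ?thesis using card_mono[of "{u}" "A w"] by simp
    qed
    have "(\<Sum>w\<in>nb v - {u}. card (A w)) \<le> card (nb v - {u}) * 1"
      by (rule sum_le_card_mult) (rule A1)
    moreover have "card (nb v - {u}) = deg v - 1" using u by simp
    moreover have "card (A u) = deg u - 1" using vu by (simp add: A_def)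
    moreover have "deg u - 1 \<le> deg v" using mx[of u] by linarith
    ultimately show ?thesis using rest by linarith
  qed
  then show ?thesis by (simp add: A_def)
qed

text \<open>The star meets at most \<open>3 * deg v\<close> edges, linear in its size, whereas the
  quota of \<open>j\<close> copies of \<open>K_m\<close> and a \<open>K_q\<close> on as many
  vertices is quadratic.\<close>

lemma reducible_deg_ge_m:
  assumes v: "v \<in> V" and d: "m \<le> deg v" and mx: "\<And>u. deg u \<le> deg v"
  shows reducible
proof -
  have i: "inc (star v) \<le> 3 * deg v"
    using inc_star_le[of v] star_contribution[OF assms] by linarith
  define j q where "j = Suc (deg v) div m" and "q = Suc (deg v) mod m"
  have c: "Suc (deg v) = j * m + q" and q: "q < m" using m_ge by (auto simp: j_def q_def)
  have j: "1 \<le> j" using c d q by (cases j) auto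
  have "2 * inc (star v) + 6 \<le> 6 * (j * m) + 6 * q" using i c by linarith
  moreover have "6 * (j * m) + 18 \<le> j * (m * (m - 1))"
  proof -
    obtain a where a: "m = a + 9" using m_ge by (metis add.commute le_Suc_ex)
    have "6 * m + 18 \<le> m * (m - 1)" unfolding a by (simp add: algebra_simps)
    then have "j * (6 * m + 18) \<le> j * (m * (m - 1))" by (rule mult_le_mono2)
    moreover have "18 \<le> j * 18" using j by simp
    ultimately show ?thesis by (simp add: algebra_simps)
  qed
  \<comment> \<open>The slack 24 is 18 from the copies of \<open>K_m\<close> and 6 from
    \<open>deg v = j * m + q - 1\<close>.\<close>
  moreover have "6 * q \<le> 24 + q * (q - 1)"
  proof (cases "q \<ge> 7")
    case True then have "q * 6 \<le> q * (q - 1)" by (intro mult_le_mono2) auto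
    then show ?thesis by linarith
  next
    case False
    then have "q \<in> {0,1,2,3,4,5,6}" by auto
    then show ?thesis by auto
  qed
  ultimately have "2 * inc (star v) \<le> j * (m * (m - 1)) + q * (q - 1)" by linarith
  then show ?thesis unfolding reducible_def using star_subset[OF v] c q card_star[of v]
    by (intro exI[of _ "star v"] exI[of _ j] exI[of _ q]) simp
qed

text \<open>In \<open>2 inc S\<close> a neighbour inside \<open>S\<close> counts once and a neighbour outside counts twice.\<close>

lemma deg_add_out_le:
  assumes "nb u \<subseteq> P \<union> Q" "finite P" "finite Q" "P \<subseteq> S"
  shows "deg u + out S u \<le> card P + 2 * card Q"
proof -
  have "card (nb u) \<le> card (P \<union> Q)" using assms by (intro card_mono) auto
  also have "\<dots> \<le> card P + card Q" by (rule card_Un_le)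
  finally have "deg u \<le> card P + card Q" .
  moreover have "out S u \<le> card Q" using assms by (intro card_mono) auto
  ultimately show ?thesis by linarith
qed

lemma card_le2: "card {a, b} \<le> 2" by (simp add: card_insert_if)
lemma card_le3: "card {a, b, c} \<le> 3" by (simp add: card_insert_if)

lemma out_le_deg: "out S u \<le> deg u" by (rule card_mono) auto

text \<open>The star has \<open>m\<close> vertices, so each may contribute \<open>m - 1\<close> on
  average. A neighbour \<open>u\<close> can exceed this only with a neighbour \<open>x\<close>
  outside the star and another one \<open>y\<close> besides \<open>v\<close>. Since \<open>x\<close>
  is not adjacent to \<open>v\<close>, these leaves confine the neighbours of almost every other
  \<open>w\<close> to \<open>{v, u, x, y}\<close>, and the contributions become constants.\<close>

lemma reducible_deg_m_minus_1:
  assumes v: "v \<in> V" and d: "Suc (deg v) = m" and mx: "\<And>u. deg u \<le> deg v"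
  shows reducible
proof -
  let ?S = "star v"
  define f where "f u = deg u + out ?S u" for u
  have f2: "f u \<le> 2 * deg v" for u using mx[of u] out_le_deg[of u ?S] by (simp add: f_def)
  have "deg v + (\<Sum>u\<in>nb v. f u) \<le> m * (m - 1)"
  proof (cases "\<forall>u\<in>nb v. out ?S u = 0 \<or> card (nb u - {v}) \<le> 1")
    case True
    have "f u \<le> m - 1" if u: "u \<in> nb v" for u
    proof (cases "out ?S u = 0")
      case False
      then have "card (nb u - {v}) \<le> 1" using bspec[OF True u] by simp
      moreover have "deg u \<le> Suc (card (nb u - {v}))"
        using diff_card_le_card_Diff[of "{v}" "nb u"] by simp
      moreover have "out ?S u \<le> card (nb u - {v})" by (rule card_mono) auto
      ultimately show ?thesis using m_ge by (simp add: f_def)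
    next
      case True
      then show ?thesis using mx[of u] d unfolding f_def by linarith
    qed
    then have "(\<Sum>u\<in>nb v. f u) \<le> deg v * (m - 1)" by (rule sum_le_card_mult)
    moreover have "m * (m - 1) = (m - 1) + deg v * (m - 1)" using d by (metis mult_Suc)
    ultimately show ?thesis using d by linarith
  next
    case False
    then obtain u where u: "u \<in> nb v" "out ?S u \<noteq> 0" "2 \<le> card (nb u - {v})" by force
    have "nb u - ?S \<noteq> {}" using u(2) by (metis card.empty)
    then obtain x where x: "x \<in> nb u - ?S" by blast
    have "1 \<le> card (nb u - {v} - {x})" using u(3) x by (simp add: card_Diff_singleton_if)
    then obtain y where y: "y \<in> nb u" "y \<noteq> v" "y \<noteq> x"
      by (metis Diff_iff One_nat_def card.empty ex_in_conv insertCI not_less_eq_eq zero_le)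
    have key: "nb w \<subseteq> {v, u, x, y}" if w: "w \<in> nb v" "w \<noteq> u" "w \<noteq> y" for w
    proof (rule subsetI, rule ccontr)
      fix z assume z: "z \<in> nb w" "z \<notin> {v, u, x, y}"
      have "distinct [v, u, w, x, y, z]" using z w u x y by auto
      then have "deg v + 3 < m + card (nb v \<inter> {x, y, z})"
        using u w x y z by (intro no_spider_count[of u v w x y z]) auto
      moreover have "nb v \<inter> {x, y, z} \<subseteq> {y, z}" using x by auto
      then have "card (nb v \<inter> {x, y, z}) \<le> card {y, z}" by (intro card_mono) auto
      ultimately show False using d card_le2[of y z] by linarith
    qed
    have s1: "(\<Sum>w\<in>nb v. f w) = f u + (\<Sum>w\<in>nb v - {u}. f w)"
      by (rule sum.remove) (use u in simp_all)
    have c1: "card (nb v - {u}) = deg v - 1" using u by simp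
    have m2: "\<exists>a. m = a + 9" using m_ge by (metis add.commute le_Suc_ex)
    show ?thesis
    \<comment> \<open>If \<open>y\<close> is in the star it cannot play the role of
      \<open>w\<close>, so \<open>f y\<close> gets the trivial bound \<open>2 * deg v\<close>. The
      others contribute at most \<open>3 + 2\<close>, or \<open>2 + 4\<close> when \<open>y\<close>
      lies outside.\<close>
    proof (cases "y \<in> nb v")
      case True
      have yu: "y \<noteq> u" using y by auto
      have "f w \<le> 5" if w: "w \<in> nb v - {u} - {y}" for w
      proof -
        have "f w \<le> card {v, u, y} + 2 * card {x}"
          unfolding f_def using key[of w] w u True by (intro deg_add_out_le) auto
        then show ?thesis using card_le3[of v u y] by simp
      qed
      then have "(\<Sum>w\<in>nb v - {u} - {y}. f w) \<le> card (nb v - {u} - {y}) * 5"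
        by (rule sum_le_card_mult)
      moreover have "card (nb v - {u} - {y}) = deg v - 2" using c1 True yu by simp
      moreover have "(\<Sum>w\<in>nb v - {u}. f w) = f y + (\<Sum>w\<in>nb v - {u} - {y}. f w)"
        by (rule sum.remove) (use True yu in simp_all)
      ultimately have "deg v + (\<Sum>w\<in>nb v. f w) + 10 \<le> 10 * deg v"
        using s1 f2[of u] f2[of y] d m_ge by simp
      moreover obtain a where a: "m = a + 9" using m2 by blast
      have "deg v = a + 8" using a d by simp
      then have "10 * deg v \<le> m * (m - 1) + 10" unfolding a by (simp add: algebra_simps)
      ultimately show ?thesis by linarith
    next
      case False
      have "f w \<le> 6" if w: "w \<in> nb v - {u}" for w
      proof -
        have "f w \<le> card {v, u} + 2 * card {x, y}"
          unfolding f_def using key[of w] w u False by (intro deg_add_out_le) auto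
        then show ?thesis using card_le2[of v u] card_le2[of x y] by linarith
      qed
      then have "(\<Sum>w\<in>nb v - {u}. f w) \<le> card (nb v - {u}) * 6"
        by (rule sum_le_card_mult)
      then have "deg v + (\<Sum>w\<in>nb v. f w) + 6 \<le> 9 * deg v"
        using s1 f2[of u] c1 d m_ge by simp
      moreover obtain a where a: "m = a + 9" using m2 by blast
      have "deg v = a + 8" using a d by simp
      then have "9 * deg v \<le> m * (m - 1) + 6" unfolding a by (simp add: algebra_simps)
      ultimately show ?thesis by linarith
    qed
  qed
  then have "2 * inc ?S \<le> m * (m - 1)" unfolding inc_star f_def .
  moreover have "card ?S = m" using d card_star by simp
  ultimately show ?thesis using star_subset[OF v] by (intro reducibleI[of ?S]) auto
qed

section \<open>Maximum degree \<open>m - 2\<close> and \<open>m - 3\<close>: stars with fewer than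
  \<open>m\<close> vertices\<close>

lemma two_inc_star_le:
  assumes "\<And>u. deg u \<le> deg v"
  shows "2 * inc (star v) \<le> (deg v + 1) * deg v + (\<Sum>u\<in>nb v. out (star v) u)"
proof -
  have "(\<Sum>u\<in>nb v. deg u) \<le> deg v * deg v" by (rule sum_le_card_mult) (rule assms)
  then show ?thesis unfolding inc_star sum.distrib by simp
qed

text \<open>Double counting of cut edges; \<open>v\<close> drops out because all its neighbours lie
  in the star.\<close>

lemma cut_star:
  assumes "finite X"
  shows "(\<Sum>x\<in>X - star v. card (nb x \<inter> star v)) = (\<Sum>u\<in>nb v. card (nb u \<inter> (X - star v)))"
proof -
  have "nb v \<inter> (X - star v) = {}" by blast
  then show ?thesis using sum_cut_swap[of "star v" "X - star v"] assms by simp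
qed

text \<open>One vertex can be added to the star. If all cut edges end in one \<open>x\<close>,
  adding \<open>x\<close> works, since its edges into and out of the star number at most
  \<open>deg v\<close> together. Otherwise two cut edges with different outer ends force small
  contributions, which leaves room for an arbitrary outer vertex.\<close>

lemma reducible_deg_m_minus_2:
  assumes v: "v \<in> V" and d: "deg v + 2 = m" and mx: "\<And>u. deg u \<le> deg v" and V: "m \<le> card V"
  shows reducible
proof -
  let ?S = "star v"
  define f where "f u = deg u + out ?S u" for u
  have SV: "?S \<subseteq> V" using star_subset[OF v] .
  have cS: "card ?S + 1 = m" using d card_star by simp
  have f2: "f u \<le> 2 * deg v" for u using mx[of u] out_le_deg[of u ?S] by (simp add: f_def)
  have "\<not> V \<subseteq> ?S" using card_mono[OF finite_star, of V v] V cS by linarith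
  then obtain x0 where x0: "x0 \<in> V" "x0 \<notin> ?S" by blast
  have fin: reducible if x: "x \<in> V" "x \<notin> ?S" and i: "2 * inc ?S + 2 * out ?S x \<le> m * (m - 1)" for x
  proof -
    have "2 * inc (insert x ?S) \<le> m * (m - 1)" using inc_insert[OF x(2)] i by simp
    moreover have "card (insert x ?S) = m" using x cS by simp
    ultimately show ?thesis using SV x by (intro reducibleI[of "insert x ?S"]) auto
  qed
  have m2: "\<exists>a. m = a + 9" using m_ge by (metis add.commute le_Suc_ex)
  then obtain a where a: "m = a + 9" by blast
  have da: "deg v = a + 7" using a d by simp
  have small: reducible if i: "2 * inc ?S + 2 * deg v \<le> m * (m - 1)"
    using fin[OF x0] i out_le_deg[of x0 ?S] mx[of x0] by linarith
  consider (one) x where "x \<in> V" "x \<notin> ?S" "\<forall>u\<in>nb v. nb u - ?S \<subseteq> {x}"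
    | (double) u x y where "u \<in> nb v" "x \<in> nb u - ?S" "y \<in> nb u - ?S" "x \<noteq> y"
    | (two) u w x z where "u \<in> nb v" "w \<in> nb v" "u \<noteq> w" "x \<noteq> z"
        "nb u - ?S = {x}" "nb w - ?S = {z}" "\<forall>q\<in>nb v. out ?S q \<le> 1"
  proof (cases "\<exists>u\<in>nb v. 2 \<le> out ?S u")
    case True
    then show ?thesis using double two_elements by metis
  next
    case False
    then have le1: "\<forall>q\<in>nb v. out ?S q \<le> 1" by force
    show ?thesis
    proof (cases "\<forall>u\<in>nb v. nb u - ?S = {}")
      case True then show ?thesis using one x0 by blast
    next
      case False
      then obtain u x where u: "u \<in> nb v" "x \<in> nb u - ?S" by blast
      have ux: "nb u - ?S = {x}"
        using le1 u card_le_Suc0_iff_eq[of "nb u - ?S"] by auto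
      have xV: "x \<in> V" "x \<notin> ?S" using u nb_in_V by auto
      show ?thesis
      proof (cases "\<forall>w\<in>nb v. nb w - ?S \<subseteq> {x}")
        case True then show ?thesis using one xV by blast
      next
        case False
        then obtain w z where w: "w \<in> nb v" "z \<in> nb w - ?S" "z \<noteq> x" by blast
        have "nb w - ?S = {z}"
          using le1 w card_le_Suc0_iff_eq[of "nb w - ?S"] by auto
        then show ?thesis using two[of u w x z] u w ux le1 by blast
      qed
    qed
  qed
  then show ?thesis
  proof cases
    case one
    have xs: "{x} - ?S = {x}" using one by blast
    have "(\<Sum>u\<in>nb v. out ?S u) = (\<Sum>u\<in>nb v. card (nb u \<inter> ({x} - ?S)))"
      by (rule sum.cong) (use one xs in \<open>auto intro!: arg_cong[of _ _ card]\<close>)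
    also have "\<dots> = card (nb x \<inter> ?S)" using cut_star[of "{x}" v] xs by simp
    finally have "2 * inc ?S \<le> (deg v + 1) * deg v + card (nb x \<inter> ?S)"
      using two_inc_star_le[OF mx] by simp
    moreover have "card (nb x \<inter> ?S) + out ?S x \<le> deg v"
      using deg_split[of x ?S] mx[of x] by simp
    ultimately have "2 * inc ?S + 2 * out ?S x \<le> (deg v + 1) * deg v + 2 * deg v" by linarith
    also have "\<dots> \<le> m * (m - 1)" unfolding da a by (simp add: algebra_simps)
    finally show ?thesis by (rule fin[OF one(1,2)])
  next
    case double
    have key: "nb w \<subseteq> {v, u, x, y}" if w: "w \<in> nb v" "w \<noteq> u" for w
    proof (rule subsetI, rule ccontr)
      fix z assume z: "z \<in> nb w" "z \<notin> {v, u, x, y}"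
      have "distinct [v, u, w, x, y, z]" using z w double by auto
      then have "deg v + 3 < m + card (nb v \<inter> {x, y, z})"
        using double w z by (intro no_spider_count[of u v w x y z]) auto
      moreover have "nb v \<inter> {x, y, z} \<subseteq> {z}" using double by auto
      then have "card (nb v \<inter> {x, y, z}) \<le> card {z}" by (intro card_mono) auto
      ultimately show False using d by simp
    qed
    have "f w \<le> 6" if w: "w \<in> nb v - {u}" for w
    proof -
      have "f w \<le> card {v, u} + 2 * card {x, y}"
        unfolding f_def using key[of w] w double by (intro deg_add_out_le) auto
      then show ?thesis using card_le2[of v u] card_le2[of x y] by linarith
    qed
    then have "(\<Sum>w\<in>nb v - {u}. f w) \<le> card (nb v - {u}) * 6"
      by (rule sum_le_card_mult)
    moreover have "card (nb v - {u}) = deg v - 1" using double by simp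
    moreover have "(\<Sum>w\<in>nb v. f w) = f u + (\<Sum>w\<in>nb v - {u}. f w)"
      by (rule sum.remove) (use double in simp_all)
    ultimately have "2 * inc ?S + 6 \<le> 9 * deg v"
      unfolding inc_star f_def[symmetric] using f2[of u] da by simp
    moreover have "11 * deg v \<le> m * (m - 1) + 6" unfolding da a by (simp add: algebra_simps)
    ultimately show ?thesis by (intro small) linarith
  next
    case two
    \<comment> \<open>With leaves \<open>x\<close>, \<open>y\<close> at \<open>u\<close> and
      \<open>z\<close> at \<open>w\<close>, only \<open>y\<close> can be adjacent to
      \<open>v\<close>, but two of the three would have to be. So \<open>u\<close> has no neighbour
      besides \<open>v\<close>, \<open>w\<close> and \<open>x\<close>, where \<open>x\<close> counts
      twice.\<close>
    have pair: "f u \<le> 4" if h: "u \<in> nb v" "w \<in> nb v" "u \<noteq> w" "x \<noteq> z"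
      "nb u - ?S = {x}" "nb w - ?S = {z}" for u w x z
    proof -
      have xz: "x \<in> nb u" "x \<notin> ?S" "z \<in> nb w" "z \<notin> ?S" using h(5,6) by blast+
      have "nb u \<subseteq> {v, w, x}"
      proof (rule subsetI, rule ccontr)
        fix y assume y: "y \<in> nb u" "y \<notin> {v, w, x}"
        have "y \<in> ?S" using y h(5) by blast
        then have yv: "y \<in> nb v" using y by blast
        have "distinct [v, u, w, x, y, z]" using y yv h(1-4) xz by auto
        then have "deg v + 3 < m + card (nb v \<inter> {x, y, z})"
          using y h(1-4) xz by (intro no_spider_count[of u v w x y z]) auto
        moreover have "nb v \<inter> {x, y, z} \<subseteq> {y}" using xz by blast
        then have "card (nb v \<inter> {x, y, z}) \<le> card {y}" by (intro card_mono) auto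
        ultimately show False using d by simp
      qed
      then have "f u \<le> card {v, w} + 2 * card {x}"
        unfolding f_def using h(2) by (intro deg_add_out_le) auto
      then show ?thesis using card_le2[of v w] by simp
    qed
    have fu: "f u \<le> 4" using pair[of u w x z] two by blast
    have fw: "f w \<le> 4" using pair[of w u z x] two by blast
    have "f q \<le> deg v + 1" if "q \<in> nb v - {u} - {w}" for q
    proof -
      have "out ?S q \<le> 1" using two(7) that by blast
      then show ?thesis using mx[of q] unfolding f_def by linarith
    qed
    then have "(\<Sum>q\<in>nb v - {u} - {w}. f q) \<le> card (nb v - {u} - {w}) * (deg v + 1)"
      by (rule sum_le_card_mult)
    moreover have "card (nb v - {u} - {w}) = deg v - 2" using two by simp
    moreover have "(\<Sum>q\<in>nb v. f q) = f u + (\<Sum>q\<in>nb v - {u}. f q)"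
      by (rule sum.remove) (use two in simp_all)
    moreover have "(\<Sum>q\<in>nb v - {u}. f q) = f w + (\<Sum>q\<in>nb v - {u} - {w}. f q)"
      by (rule sum.remove) (use two in simp_all)
    ultimately have "2 * inc ?S \<le> deg v + 8 + (deg v - 2) * (deg v + 1)"
      unfolding inc_star f_def[symmetric] using fu fw by simp
    moreover have "deg v + 8 + (deg v - 2) * (deg v + 1) + 2 * deg v \<le> m * (m - 1)"
      unfolding da a by (simp add: algebra_simps)
    ultimately show ?thesis by (intro small) linarith
  qed
qed

lemma reducible_add_two:
  assumes "v \<in> V" "deg v + 3 = m" "x \<in> V - star v" "y \<in> V - star v" "x \<noteq> y"
    and i: "2 * inc (star v) + 2 * out (star v) x + 2 * out (star v) y \<le> m * (m - 1)"
  shows reducible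
proof -
  have "inc (star v \<union> {x, y}) \<le> inc (star v) + (\<Sum>a\<in>{x, y}. out (star v) a)"
    by (rule inc_Un_le) (use assms in auto)
  then have "2 * inc (star v \<union> {x, y}) \<le> m * (m - 1)" using i assms(5) by simp
  moreover have "card (star v \<union> {x, y}) = card (star v) + card {x, y}"
    by (rule card_Un_disjoint) (use assms in auto)
  then have c: "card (star v \<union> {x, y}) = m" using assms(2,5) card_star[of v] by simp
  ultimately have "2 * inc (star v \<union> {x, y})
      \<le> card (star v \<union> {x, y}) * (card (star v \<union> {x, y}) - 1)" by (simp only: c)
  then show ?thesis using assms(1,3,4) star_subset[of v] c
    by (intro reducibleI[of "star v \<union> {x, y}"]) auto
qed

text \<open>Adding both ends of the cut works: the edges of each end into and out of the star number
  at most \<open>deg v\<close>, and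
  \<open>d * (d + 1) + 4 * d \<le> (d + 3) * (d + 2)\<close>.\<close>

lemma reducible_two_ends:
  assumes v: "v \<in> V" and d: "deg v + 3 = m" and mx: "\<And>u. deg u \<le> deg v"
    and xy: "x \<in> V - star v" "y \<in> V - star v" "x \<noteq> y"
    and ends: "\<And>u. u \<in> nb v \<Longrightarrow> nb u - star v \<subseteq> {x, y}"
  shows reducible
proof -
  let ?S = "star v"
  have XS: "{x, y} - ?S = {x, y}" using xy by blast
  have "(\<Sum>u\<in>nb v. out ?S u) = (\<Sum>u\<in>nb v. card (nb u \<inter> ({x, y} - ?S)))"
    by (rule sum.cong) (use ends XS in \<open>auto intro!: arg_cong[of _ _ card]\<close>)
  also have "\<dots> = card (nb x \<inter> ?S) + card (nb y \<inter> ?S)"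
    using cut_star[of "{x, y}" v] XS xy by simp
  finally have "2 * inc ?S \<le> (deg v + 1) * deg v + (card (nb x \<inter> ?S) + card (nb y \<inter> ?S))"
    using two_inc_star_le[OF mx] by simp
  moreover have "card (nb x \<inter> ?S) + out ?S x \<le> deg v" "card (nb y \<inter> ?S) + out ?S y \<le> deg v"
    using deg_split[of x ?S] deg_split[of y ?S] mx[of x] mx[of y] by simp_all
  ultimately have "2 * inc ?S + 2 * out ?S x + 2 * out ?S y \<le> (deg v + 1) * deg v + 4 * deg v"
    by linarith
  also have "\<dots> \<le> m * (m - 1)" unfolding d[symmetric] by (simp add: algebra_simps)
  finally show ?thesis by (rule reducible_add_two[OF v d xy])
qed

text \<open>Here a configuration with all three leaves outside the star is forbidden. If
  \<open>u\<close> has exactly two outer neighbours, every cut edge must end in one of them. If it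
  has more, no other vertex of the star has an outer neighbour, and the missing edges at
  \<open>u\<close> inside the star compensate for the cut.\<close>

lemma reducible_wide_cut:
  assumes v: "v \<in> V" and d: "deg v + 3 = m" and mx: "\<And>u. deg u \<le> deg v"
    and u: "u \<in> nb v" "2 \<le> out (star v) u"
  shows reducible
proof -
  let ?S = "star v"
  have key: False if h: "u \<in> nb v" "w \<in> nb v" "w \<noteq> u" "z \<in> nb w - ?S"
    "x \<in> nb u - ?S - {z}" "y \<in> nb u - ?S - {z}" "x \<noteq> y" for u w x y z
  proof -
    have "distinct [v, u, w, x, y, z]" using h by auto
    then have "deg v + 3 < m + card (nb v \<inter> {x, y, z})"
      using h by (intro no_spider_count[of u v w x y z]) auto
    moreover have "nb v \<inter> {x, y, z} = {}" using h by blast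
    then have "card (nb v \<inter> {x, y, z}) = 0" by (simp only: card.empty)
    ultimately show False using d by linarith
  qed
  show ?thesis
  proof (cases "out ?S u = 2")
    case True
    then obtain x y where xy: "nb u - ?S = {x, y}" "x \<noteq> y" by (meson card_2_iff)
    have m: "x \<in> nb u - ?S" "y \<in> nb u - ?S" using xy(1) by simp_all
    have e: "nb w - ?S \<subseteq> {x, y}" if w: "w \<in> nb v" for w
    proof (rule subsetI, rule ccontr)
      fix z assume z: "z \<in> nb w - ?S" "z \<notin> {x, y}"
      then have "w \<noteq> u" using xy(1) by blast
      then show False using key[of u w z x y] z w u m xy(2) by blast
    qed
    show ?thesis
      by (rule reducible_two_ends[OF v d mx _ _ xy(2)]) (use m nb_in_V e in blast)+
  next
    case False
    then have u3: "3 \<le> out ?S u" using u by linarith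
    have z: "nb w - ?S = {}" if w: "w \<in> nb v" "w \<noteq> u" for w
    proof (rule ccontr)
      assume "nb w - ?S \<noteq> {}"
      then obtain z where z: "z \<in> nb w - ?S" by blast
      have "2 \<le> card (nb u - ?S - {z})"
        using diff_card_le_card_Diff[of "{z}" "nb u - ?S"] u3 by simp
      then obtain x y where "x \<in> nb u - ?S - {z}" "y \<in> nb u - ?S - {z}" "x \<noteq> y"
        using two_elements by metis
      then show False using key[of u w z x y] z w u by blast
    qed
    define f where "f w = deg w + out ?S w" for w
    let ?M = "nb v - {u} - nb u"
    \<comment> \<open>A vertex of \<open>?M\<close> misses itself and \<open>u\<close> and has no
      outer neighbour, so its degree falls short of \<open>deg v\<close>. Each such vertex pays for
      one cut edge at \<open>u\<close>; there are enough of them because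
      \<open>deg u \<le> deg v\<close>.\<close>
    have fw: "f w + (if w \<in> ?M then 1 else 0) \<le> deg v" if w: "w \<in> nb v - {u}" for w
    proof -
      have zw: "nb w - ?S = {}" using z w by blast
      then have f: "f w = deg w" unfolding f_def zw by simp
      show ?thesis
      proof (cases "w \<in> ?M")
        case True
        then have "u \<notin> nb w" using nb_sym by blast
        then have "nb w \<subseteq> ?S - {u, w}" using zw nb_irrefl[of w] by blast
        then have "deg w \<le> card (?S - {u, w})" by (intro card_mono) auto
        also have "\<dots> = card ?S - card {u, w}" by (rule card_Diff_subset) (use w u in auto)
        also have "card {u, w} = 2" using w by auto
        also have "card ?S - 2 = deg v - 1" by simp
        finally show ?thesis using f True d m_ge by simp
      next
        case False
        then show ?thesis using f mx[of w] by (simp only: if_False)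
      qed
    qed
    have c1: "card (nb v - {u}) = deg v - 1" using u by simp
    have "(\<Sum>w\<in>nb v - {u}. f w + (if w \<in> ?M then 1 else 0)) \<le> card (nb v - {u}) * deg v"
      by (rule sum_le_card_mult) (rule fw)
    moreover have "(\<Sum>w\<in>nb v - {u}. (if w \<in> ?M then 1 else (0::nat))) = card ?M"
    proof -
      have "(\<Sum>w\<in>nb v - {u}. (if w \<in> ?M then 1 else (0::nat))) = card ((nb v - {u}) \<inter> ?M)"
        by (subst sum.If_cases) (simp_all only: finite_Diff finite_nb Collect_mem_eq sum.neutral_const
          card_eq_sum add_0_right)
      also have "(nb v - {u}) \<inter> ?M = ?M" by blast
      finally show ?thesis .
    qed
    ultimately have 1: "(\<Sum>w\<in>nb v - {u}. f w) + card ?M \<le> (deg v - 1) * deg v"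
      unfolding sum.distrib c1 by linarith
    have "out ?S u \<le> card ?M"
    proof -
      have vu: "v \<in> nb u" using u nb_sym by blast
      have "nb u \<inter> ?S = insert v (nb u \<inter> nb v)" using vu by blast
      then have "card (nb u \<inter> ?S) = Suc (card (nb u \<inter> nb v))" by simp
      then have "Suc (card (nb u \<inter> nb v)) + out ?S u \<le> deg v"
        using deg_split[of u ?S] mx[of u] by linarith
      moreover have "nb v - {u} - (nb u \<inter> nb v) = ?M" by blast
      then have "card (nb v - {u}) - card (nb u \<inter> nb v) \<le> card ?M"
        using diff_card_le_card_Diff[of "nb u \<inter> nb v" "nb v - {u}"] by simp
      ultimately show ?thesis using c1 by linarith
    qed
    moreover have "(\<Sum>w\<in>nb v. f w) = f u + (\<Sum>w\<in>nb v - {u}. f w)"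
      by (rule sum.remove) (use u in simp_all)
    moreover have "f u \<le> deg v + out ?S u" using mx[of u] by (simp add: f_def)
    moreover have "2 * inc ?S = deg v + (\<Sum>w\<in>nb v. f w)" unfolding inc_star f_def ..
    ultimately have "2 * inc ?S \<le> deg v + deg v + (deg v - 1) * deg v" using 1 by linarith
    also have "\<dots> = card ?S * (card ?S - 1)" using d m_ge unfolding card_star
      by (cases "deg v") (auto simp: algebra_simps)
    finally show ?thesis using star_subset[OF v] card_star[of v] d
      by (intro reducibleI[of ?S]) auto
  qed
qed

text \<open>If every vertex of the star with a neighbour outside has degree below the maximum, the star
  itself can be deleted. Otherwise let \<open>u\<close> be such a vertex of maximum degree, with \<open>z\<close> its neighbour
  outside. Exactly one vertex \<open>u'\<close> of the star is not adjacent to \<open>u\<close>; it lies outside the star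
  of \<open>u\<close>, so a neighbour of \<open>u'\<close> cannot also be joined to a vertex other than \<open>z\<close> outside the star of
  \<open>v\<close>. Hence many edges out of the star, unless they end in \<open>z\<close>, force a small degree of \<open>u'\<close>.\<close>

lemma reducible_deg_m_minus_3:
  assumes v: "v \<in> V" and d: "deg v + 3 = m" and mx: "\<And>u. deg u \<le> deg v" and V: "m \<le> card V"
  shows reducible
proof (rule ccontr)
  assume nr: "\<not> reducible"
  let ?S = "star v"
  have le1: "out ?S q \<le> 1" if "q \<in> nb v" for q
    using reducible_wide_cut[OF v d mx that] nr by fastforce
  define f where "f w = deg w + out ?S w" for w
  have ex: "\<exists>u\<in>nb v. out ?S u \<noteq> 0 \<and> deg u = deg v"
  proof (rule ccontr)
    assume h: "\<not> ?thesis"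
    have "f q \<le> deg v" if q: "q \<in> nb v" for q
    proof (cases "out ?S q = 0")
      case True
      then show ?thesis using mx[of q] unfolding f_def by linarith
    next
      case False
      then have "deg q \<noteq> deg v" using h q by blast
      then show ?thesis using mx[of q] le1[OF q] unfolding f_def by linarith
    qed
    then have "(\<Sum>w\<in>nb v. f w) \<le> deg v * deg v" by (rule sum_le_card_mult)
    then have "2 * inc ?S \<le> card ?S * (card ?S - 1)"
      unfolding card_star inc_star f_def[symmetric] by simp
    then have reducible using star_subset[OF v] card_star[of v] d
      by (intro reducibleI[of ?S]) auto
    then show False using nr by blast
  qed
  then obtain u where u: "u \<in> nb v" "out ?S u \<noteq> 0" "deg u = deg v" by blast
  then have "out ?S u = 1" using le1[OF u(1)] by linarith
  then obtain z where z: "nb u - ?S = {z}" using card_1_singletonE by blast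
  have zu: "z \<in> nb u" "z \<notin> ?S" using z by blast+
  have vu: "v \<in> nb u" using u nb_sym by blast
  have uV: "u \<in> V" using u nb_in_V by blast
  \<comment> \<open>Since \<open>u\<close> also has maximum degree, the bound on wide cuts applies
    to its star as well.\<close>
  have le1': "out (star u) q \<le> 1" if "q \<in> nb u" for q
    using reducible_wide_cut[OF uV _ _ that] nr d u(3) mx by fastforce
  have "card (?S - {u} - nb u) = 1"
  proof -
    have "card (nb u \<inter> ?S) + 1 = deg v" using deg_split[of u ?S] \<open>out ?S u = 1\<close> u(3) by linarith
    moreover have "?S - {u} - nb u = (?S - {u}) - (nb u \<inter> ?S)" by blast
    moreover have "card ((?S - {u}) - (nb u \<inter> ?S)) = card (?S - {u}) - card (nb u \<inter> ?S)"
      by (rule card_Diff_subset) (use nb_irrefl[of u] in auto)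
    moreover have "card (?S - {u}) = deg v"
      using card_Diff_singleton[of u ?S] u(1) card_star[of v] by simp
    ultimately show ?thesis by simp
  qed
  then obtain u' where u': "?S - {u} - nb u = {u'}" using card_1_singletonE by blast
  then have "u' \<in> ?S - {u} - nb u" by simp
  then have u's: "u' \<in> nb v" "u' \<noteq> u" "u' \<notin> nb u" using vu by auto
  define C where "C = {q \<in> nb v. nb q - ?S - {z} \<noteq> {}}"
  have fC: "finite C" by (simp add: C_def)
  have uC: "u \<notin> C" using z by (auto simp: C_def)
  have nonadj: "q \<notin> nb u'" if q: "q \<in> C" "q \<noteq> u'" for q
  proof
    assume qu': "q \<in> nb u'"
    obtain a where a: "a \<in> nb q" "a \<notin> ?S" "a \<noteq> z" using q by (auto simp: C_def)
    have "q \<in> nb u" using q uC u' by (auto simp: C_def)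
    have "a \<notin> star u" using a z u by blast
    moreover have "u' \<notin> star u" using u's by blast
    moreover have "u' \<in> nb q" using qu' nb_sym by blast
    ultimately have "{a, u'} \<subseteq> nb q - star u" using a by blast
    then have "card {a, u'} \<le> out (star u) q" by (intro card_mono) auto
    moreover have "a \<noteq> u'" using a u's by blast
    ultimately show False using le1'[OF \<open>q \<in> nb u\<close>] by simp
  qed
  have du': "deg u' + card C \<le> deg v + 1"
  proof -
    \<comment> \<open>Inside the star \<open>u'\<close> misses \<open>u\<close>, itself and
      \<open>C\<close>. The final \<open>+ 1\<close> accounts both for a possible outer neighbour of
      \<open>u'\<close> and for \<open>u' \<in> C\<close>, by way of the \<open>- 1\<close> for the
      missed \<open>u\<close>.\<close>
    have "nb u' \<inter> ?S \<subseteq> ?S - {u, u'} - (C - {u'})"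
      using nonadj u's(3) nb_irrefl[of u'] nb_sym[of u u'] by blast
    then have "card (nb u' \<inter> ?S) \<le> card (?S - {u, u'} - (C - {u'}))" by (intro card_mono) auto
    also have "\<dots> = card (?S - {u, u'}) - card (C - {u'})"
      by (rule card_Diff_subset) (use uC fC in \<open>auto simp: C_def\<close>)
    also have "card (?S - {u, u'}) = card ?S - card {u, u'}"
      by (rule card_Diff_subset) (use u u's in auto)
    also have "card ?S - card {u, u'} = deg v - 1" using u's(2) card_star[of v] by simp
    finally have 1: "card (nb u' \<inter> ?S) \<le> deg v - 1 - card (C - {u'})" .
    have "card (C - {u'}) \<le> card (?S - {u, u'})"
      by (rule card_mono) (use uC in \<open>auto simp: C_def\<close>)
    also have "\<dots> = card ?S - card {u, u'}"
      by (rule card_Diff_subset) (use u u's in auto)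
    also have "\<dots> = deg v - 1" using u's(2) card_star[of v] by simp
    finally have 2: "card (C - {u'}) \<le> deg v - 1" .
    have "card C \<le> card (C - {u'}) + 1" using diff_card_le_card_Diff[of "{u'}" C] by simp
    then show ?thesis using 1 2 deg_split[of u' ?S] le1[OF u's(1)] d m_ge by linarith
  qed
  have cut: "(\<Sum>q\<in>nb v. out ?S q) \<le> card C + card (nb z \<inter> ?S)"
  proof -
    have "out ?S q \<le> (if q \<in> C then 1 else 0) + (if q \<in> nb z then 1 else 0)" if q: "q \<in> nb v" for q
    proof (cases "q \<in> C \<or> q \<in> nb z")
      case True
      then have "1 \<le> (if q \<in> C then 1 else 0) + (if q \<in> nb z then 1 else (0::nat))" by auto
      then show ?thesis using le1[OF q] by linarith
    next
      case False
      then have "z \<notin> nb q" using nb_sym by blast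
      then have "nb q - ?S = {}" using False q by (auto simp: C_def)
      then have "out ?S q = 0" by (simp only: card.empty)
      then show ?thesis by linarith
    qed
    then have "(\<Sum>q\<in>nb v. out ?S q)
        \<le> (\<Sum>q\<in>nb v. (if q \<in> C then 1 else 0) + (if q \<in> nb z then 1 else 0))"
      by (rule sum_mono)
    also have "\<dots> = card (nb v \<inter> C) + card (nb v \<inter> nb z)"
      by (simp add: sum.distrib sum.If_cases)
    also have "\<dots> \<le> card C + card (nb z \<inter> ?S)"
      by (intro add_mono card_mono) (use fC in auto)
    finally show ?thesis .
  qed
  have degs: "(\<Sum>q\<in>nb v. deg q) \<le> deg u' + (deg v - 1) * deg v"
  proof -
    have "(\<Sum>q\<in>nb v. deg q) = deg u' + (\<Sum>q\<in>nb v - {u'}. deg q)"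
      by (rule sum.remove) (use u's in simp_all)
    moreover have "(\<Sum>q\<in>nb v - {u'}. deg q) \<le> card (nb v - {u'}) * deg v"
      by (rule sum_le_card_mult) (rule mx)
    moreover have "card (nb v - {u'}) = deg v - 1" using u's(1) by simp
    ultimately show ?thesis by simp
  qed
  have "2 * inc ?S \<le> deg v + (deg v - 1) * deg v + deg v + 1 + card (nb z \<inter> ?S)"
    using inc_star[of v] cut degs du' unfolding sum.distrib by linarith
  moreover have "card (nb z \<inter> ?S) + out ?S z \<le> deg v" using deg_split[of z ?S] mx[of z] by simp
  moreover have "\<not> V \<subseteq> insert z ?S"
  proof
    assume "V \<subseteq> insert z ?S"
    then have "card V \<le> card (insert z ?S)" by (intro card_mono) auto
    also have "\<dots> \<le> Suc (card ?S)" by (rule card_insert_le_m1) auto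
    finally show False using V d card_star[of v] by linarith
  qed
  then obtain y where y: "y \<in> V - ?S" "z \<noteq> y" by blast
  moreover have "out ?S y \<le> deg v" using out_le_deg[of y ?S] mx[of y] by linarith
  \<comment> \<open>The star is filled up with \<open>z\<close>, which absorbs the cut edges ending
    there, and an arbitrary \<open>y\<close>. The term \<open>card C\<close> has cancelled against
    the small degree of \<open>u'\<close>.\<close>
  ultimately have "2 * inc ?S + 2 * out ?S z + 2 * out ?S y
      \<le> deg v + (deg v - 1) * deg v + 5 * deg v + 1" by linarith
  also have "\<dots> \<le> m * (m - 1)" unfolding d[symmetric] using d m_ge
    by (cases "deg v") (auto simp: algebra_simps)
  finally have i: "2 * inc ?S + 2 * out ?S z + 2 * out ?S y \<le> m * (m - 1)" .
  have "z \<in> V - ?S" using zu nb_in_V by blast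
  then have reducible using y i by (intro reducible_add_two[OF v d])
  then show False using nr by blast
qed

section \<open>The upper bound by induction on the number of vertices\<close>

lemma reducible_if_large_degree:
  assumes V: "m \<le> card V" and u: "u \<in> V" "m < deg u + 4"
  shows reducible
proof -
  define D where "D = Max (deg ` V)"
  have "D \<in> deg ` V" unfolding D_def using u by (intro Max_in) auto
  then obtain v where v: "v \<in> V" "deg v = D" by auto
  have le: "deg w \<le> deg v" if "w \<in> V" for w unfolding v D_def using that by (intro Max_ge) auto
  have mx: "deg w \<le> deg v" for w
  proof (cases "w \<in> V")
    case False
    then have "nb w = {}" using nb_in_V by blast
    then show ?thesis by simp
  qed (rule le)
  have "m < deg v + 4" using mx[of u] u by linarith
  then consider "m \<le> deg v" | "Suc (deg v) = m" | "deg v + 2 = m" | "deg v + 3 = m" by linarith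
  then show ?thesis
    using reducible_deg_ge_m[OF v(1) _ mx] reducible_deg_m_minus_1[OF v(1) _ mx]
      reducible_deg_m_minus_2[OF v(1) _ mx V] reducible_deg_m_minus_3[OF v(1) _ mx V] by cases blast+
qed

lemma spider_free_remove: "spider_free (V - S) {e \<in> E. e \<inter> S = {}} m"
proof -
  let ?F = "{e \<in> E. e \<inter> S = {}}"
  interpret H: sgraph "V - S" ?F
    using sg by unfold_locales (fastforce simp: simple_graph_def)
  have sub: "H.nb u \<subseteq> nb u" for u by (auto simp: H.nb_def nb_def)
  show ?thesis
  proof unfold_locales
    fix v u w x y z
    assume "u \<in> H.nb v" "w \<in> H.nb v" "x \<in> H.nb u" "y \<in> H.nb u" "z \<in> H.nb w"
      "distinct [v, u, w, x, y, z]"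
    then have "card (nb v - {u, w, x, y, z}) + 5 < m"
      using sub by (intro no_spider) blast+
    moreover have "card (H.nb v - {u, w, x, y, z}) \<le> card (nb v - {u, w, x, y, z})"
      using sub[of v] by (intro card_mono) auto
    ultimately show "card (H.nb v - {u, w, x, y, z}) + 5 < m" by linarith
  qed (rule m_ge)
qed

end

lemma spider_free_edges:
  "spider_free V E m \<Longrightarrow> bounded_by m (card V) (2 * card E)"
proof (induction "card V" arbitrary: V E rule: less_induct)
  case less
  interpret spider_free V E m by (rule less.prems)
  have degV: "deg u \<le> card V - 1" if "u \<in> V" for u
    using card_mono[OF _ nb_subset[of u]] that by simp
  consider "card V < m" | "m \<le> card V" "\<forall>u\<in>V. deg u \<le> m - 4"
    | "m \<le> card V" "\<exists>u\<in>V. m < deg u + 4" by force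
  then show ?case
  proof cases
    case 1
    have "2 * card E \<le> card V * (card V - 1)"
      unfolding handshake by (rule sum_le_card_mult) (rule degV)
    then show ?thesis using bounded_by_small[OF 1] bounded_by_mono by blast
  next
    case 2
    have "2 * card E \<le> card V * (m - 4)"
      unfolding handshake by (rule sum_le_card_mult) (use 2 in blast)
    then show ?thesis using bounded_by_regular[of m "card V"] 2 m_ge bounded_by_mono
      by (simp add: mult.commute)
  next
    case 3
    then have reducible using reducible_if_large_degree by blast
    then obtain S j w where S: "S \<subseteq> V" "S \<noteq> {}" "card S = j * m + w" "w \<le> m"
      "2 * inc S \<le> j * (m * (m - 1)) + w * (w - 1)" unfolding reducible_def by blast
    let ?F = "{e \<in> E. e \<inter> S = {}}"
    have fS: "finite S" using S finite_V finite_subset by blast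
    have cV: "card V = card (V - S) + card S"
      using card_Diff_subset[OF fS S(1)] card_mono[OF finite_V S(1)] by linarith
    have "card S > 0" using S(2) fS card_gt_0_iff by blast
    then have "bounded_by m (card (V - S)) (2 * card ?F)"
      using cV by (intro less.hyps spider_free_remove) linarith
    \<comment> \<open>The deleted part is paid back in two instalments, the \<open>K_w\<close> and
      the \<open>j\<close> copies of \<open>K_m\<close>.\<close>
    then have "bounded_by m (card (V - S) + w) (2 * card ?F + w * (w - 1))"
      using S m_ge by (intro bounded_by_add_part) auto
    then have "bounded_by m (j * m + (card (V - S) + w))
        (j * (m * (m - 1)) + (2 * card ?F + w * (w - 1)))"
      by (rule bounded_by_add_full)
    moreover have p: "j * m + (card (V - S) + w) = card V" using cV S by linarith
    moreover have "2 * card E \<le> j * (m * (m - 1)) + (2 * card ?F + w * (w - 1))"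
      using card_E_remove[of S] S by linarith
    ultimately show ?thesis unfolding p by (elim bounded_by_mono)
  qed
qed

section \<open>Extremal graphs\<close>

lemma Tpp_E_cases:
  assumes "e \<in> Tpp_E n"
  obtains i where "1 \<le> i" "i \<le> n - 4" "e = {0, i}"
    | "e = {1, n - 3}" | "e = {1, n - 2}" | "e = {2, n - 1}"
  using assms unfolding Tpp_E_def by blast

lemma inj_on_UnI:
  "inj_on f A \<Longrightarrow> inj_on f B \<Longrightarrow> f ` A \<inter> f ` B = {} \<Longrightarrow> inj_on f (A \<union> B)"
  unfolding inj_on_Un by blast

lemma spider_free_if_no_copy:
  assumes n: "10 \<le> n" and sg: "simple_graph V E"
    and nc: "\<not> contains_copy V E (Tpp_V n) (Tpp_E n)"
  shows "spider_free V E (n - 1)"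
proof -
  interpret sgraph V E by unfold_locales (rule sg)
  show ?thesis
  proof unfold_locales
    show "9 \<le> n - 1" using n by simp
    fix v u w x y z
    assume uv: "u \<in> nb v" and wv: "w \<in> nb v" and xu: "x \<in> nb u" and yu: "y \<in> nb u"
      and zw: "z \<in> nb w" and dist: "distinct [v, u, w, x, y, z]"
    show "card (nb v - {u, w, x, y, z}) + 5 < n - 1"
    proof (rule ccontr)
      let ?B = "nb v - {u, w, x, y, z}" and ?M = "{3..n - 4}" and ?L = "{0, 1, 2, n - 3, n - 2, n - 1}"
      assume "\<not> ?thesis"
      then have "card ?M \<le> card ?B" using n by simp
      then obtain g where g: "g ` ?M \<subseteq> ?B" "inj_on g ?M"
        using card_le_inj[of ?M ?B] by auto
      \<comment> \<open>The centre and its two branching neighbours are 0, 1, 2, their leaves are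
        the last three vertices, and \<open>g\<close> places the remaining \<open>n - 6\<close>
        leaves of the centre.\<close>
      define f where "f i = (if i = 0 then v else if i = 1 then u else if i = 2 then w
        else if i = n - 3 then x else if i = n - 2 then y else if i = n - 1 then z else g i)" for i
      have fL: "f 0 = v" "f 1 = u" "f 2 = w" "f (n - 3) = x" "f (n - 2) = y" "f (n - 1) = z"
        using n by (auto simp: f_def)
      have fM: "f i = g i" if "i \<in> ?M" for i using that n by (auto simp: f_def)
      have V: "Tpp_V n = ?L \<union> ?M" using n unfolding Tpp_V_def by auto
      have imL: "f ` ?L = {v, u, w, x, y, z}" by (simp only: image_insert image_empty fL)
      have "card {v, u, w, x, y, z} = 6" using dist by simp
      moreover have "card ?L \<le> 6" by (simp add: card_insert_if)
      moreover have "card (f ` ?L) \<le> card ?L" by (rule card_image_le) simp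
      ultimately have "inj_on f ?L" by (intro eq_card_imp_inj_on) (simp_all only: imL finite.intros)
      moreover have "inj_on f ?M" using g(2) fM by (simp add: inj_on_def)
      moreover have imM: "f ` ?M \<subseteq> ?B" using g(1) fM by auto
      have "f ` ?L \<inter> f ` ?M = {}"
      proof -
        have "f ` ?L \<inter> f ` ?M \<subseteq> {v, u, w, x, y, z} \<inter> ?B"
          unfolding imL by (rule Int_mono[OF order_refl imM])
        also have "\<dots> = {}" by simp
        finally show ?thesis by (rule equalityI[OF _ empty_subsetI])
      qed
      ultimately have "inj_on f (Tpp_V n)" unfolding V by (rule inj_on_UnI)
      moreover have "f ` Tpp_V n \<subseteq> V"
      proof -
        have "f ` Tpp_V n = f ` ?L \<union> f ` ?M" unfolding V by (rule image_Un)
        moreover have "{v, u, w, x, y, z} \<subseteq> V" using uv wv xu yu zw nb_in_V by blast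
        moreover have "?B \<subseteq> V" using nb_in_V by blast
        moreover have "f ` ?M \<subseteq> V" by (rule subset_trans[OF imM \<open>?B \<subseteq> V\<close>])
        ultimately show ?thesis unfolding imL by (simp only: Un_subset_iff)
      qed
      moreover have "f ` e \<in> E" if "e \<in> Tpp_E n" for e
        using that
      proof (cases rule: Tpp_E_cases)
        case (1 i)
        have "f i \<in> nb v"
        proof (cases "i \<le> 2")
          case True
          then have "i = 1 \<or> i = 2" using 1 by auto
          then show ?thesis using fL uv wv by auto
        next
          case False
          then have "i \<in> ?M" using 1 by simp
          then show ?thesis using subsetD[OF imM imageI] by blast
        qed
        then show ?thesis using 1 fL by (simp add: nb_def)
      qed (use fL xu yu zw in \<open>simp_all add: nb_def\<close>)
      ultimately show False using nc unfolding contains_copy_def by blast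
    qed
  qed
qed

section \<open>Copy-free graphs that attain the bound\<close>

definition admissible :: "nat \<Rightarrow> nat \<Rightarrow> nat \<Rightarrow> bool" where
  "admissible n p q \<longleftrightarrow> (\<exists>E. simple_graph {0..<p} E \<and>
     \<not> contains_copy {0..<p} E (Tpp_V n) (Tpp_E n) \<and> card E = q)"

lemma simple_graph_pairs:
  assumes "finite A"
  shows "simple_graph A {e. e \<subseteq> A \<and> card e = 2}"
  using assms unfolding simple_graph_def card_2_iff by blast

lemma no_copy_small: "p < n \<Longrightarrow> \<not> contains_copy {0..<p} E (Tpp_V n) EL"
  unfolding contains_copy_def Tpp_V_def
  by (metis card_atLeastLessThan card_inj_on_le diff_zero finite_atLeastLessThan linorder_not_le)

lemma admissible_clique: "p < n \<Longrightarrow> admissible n p (p choose 2)"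
  unfolding admissible_def
  by (intro exI[of _ "{e. e \<subseteq> {0..<p} \<and> card e = 2}"])
    (simp add: simple_graph_pairs no_copy_small n_subsets)

text \<open>Connectedness as invariance of predicates along edges. Applied to
  \<open>f i < p\<close>, it confines a copy to one side of a disjoint union.\<close>

lemma Tpp_connected:
  assumes n: "10 \<le> n" and Q: "\<And>i j. {i, j} \<in> Tpp_E n \<Longrightarrow> Q i \<longleftrightarrow> Q j" and i: "i < n"
  shows "Q i \<longleftrightarrow> Q 0"
proof -
  have a: "Q i \<longleftrightarrow> Q 0" if "1 \<le> i" "i \<le> n - 4" for i
    using Q[of 0 i] that unfolding Tpp_E_def by blast
  have b: "Q 1 \<longleftrightarrow> Q (n - 3)" "Q 1 \<longleftrightarrow> Q (n - 2)" "Q 2 \<longleftrightarrow> Q (n - 1)"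
    by (rule Q, simp add: Tpp_E_def)+
  consider "i = 0" | "1 \<le> i" "i \<le> n - 4" | "i = n - 3" | "i = n - 2" | "i = n - 1"
    using i by linarith
  then show ?thesis using a[of i] a[of 1] a[of 2] b n by cases auto
qed

text \<open>The tree is connected, so a copy would lie in the old graph or in the new clique, which
  has one vertex too few.\<close>

lemma admissible_add_clique:
  assumes n: "10 \<le> n" and ad: "admissible n p q"
  shows "admissible n (p + (n - 1)) (q + ((n - 1) choose 2))"
proof -
  obtain E where sg: "simple_graph {0..<p} E"
    and nc: "\<not> contains_copy {0..<p} E (Tpp_V n) (Tpp_E n)" and c: "card E = q"
    using ad unfolding admissible_def by blast
  let ?A = "{p..<p + (n - 1)}"
  define K where "K = {e. e \<subseteq> ?A \<and> card e = 2}"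
  have EV: "e \<subseteq> {0..<p} \<and> e \<noteq> {}" if "e \<in> E" for e
    using sg that unfolding simple_graph_def by fastforce
  have KV: "e \<subseteq> ?A \<and> e \<noteq> {}" if "e \<in> K" for e using that by (auto simp: K_def)
  have "finite E" using EV by (intro finite_subset[of E "Pow {0..<p}"]) auto
  moreover have "finite K" using KV by (intro finite_subset[of K "Pow ?A"]) auto
  moreover have "E \<inter> K = {}"
  proof -
    have False if e: "e \<in> E" "e \<in> K" for e
    proof -
      obtain a where "a \<in> e" using EV[OF e(1)] by blast
      then show False using EV[OF e(1)] KV[OF e(2)] by fastforce
    qed
    then show ?thesis by blast
  qed
  ultimately have "card (E \<union> K) = q + ((n - 1) choose 2)"
    using c by (simp add: card_Un_disjoint K_def n_subsets)
  moreover have "simple_graph {0..<p + (n - 1)} (E \<union> K)"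
  proof -
    have "{0..<p} \<subseteq> {0..<p + (n - 1)}" "?A \<subseteq> {0..<p + (n - 1)}" by auto
    moreover have "\<exists>u v. u \<in> {0..<p} \<and> v \<in> {0..<p} \<and> u \<noteq> v \<and> e = {u, v}" if "e \<in> E" for e
      using conjunct2[OF sg[unfolded simple_graph_def]] that by (rule bspec)
    moreover have "\<exists>u v. u \<in> ?A \<and> v \<in> ?A \<and> u \<noteq> v \<and> e = {u, v}" if "e \<in> K" for e
      using conjunct2[OF simple_graph_pairs[of ?A, unfolded simple_graph_def, OF finite_atLeastLessThan]] that
      unfolding K_def by (rule bspec)
    ultimately have "\<exists>u v. u \<in> {0..<p + (n - 1)} \<and> v \<in> {0..<p + (n - 1)} \<and> u \<noteq> v \<and> e = {u, v}"
      if "e \<in> E \<union> K" for e using that by (elim UnE) (meson subsetD)+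
    then show ?thesis unfolding simple_graph_def by simp
  qed
  moreover have "\<not> contains_copy {0..<p + (n - 1)} (E \<union> K) (Tpp_V n) (Tpp_E n)"
  proof
    assume "contains_copy {0..<p + (n - 1)} (E \<union> K) (Tpp_V n) (Tpp_E n)"
    then obtain f where f: "inj_on f (Tpp_V n)" "f ` Tpp_V n \<subseteq> {0..<p + (n - 1)}"
      "\<forall>e\<in>Tpp_E n. f ` e \<in> E \<union> K" unfolding contains_copy_def by (elim exE conjE)
    have same: "f i < p \<longleftrightarrow> f 0 < p" if "i < n" for i
    proof (rule Tpp_connected[OF n _ that])
      fix i j assume "{i, j} \<in> Tpp_E n"
      then have "{f i, f j} \<in> E \<or> {f i, f j} \<in> K" using f(3)[THEN bspec, of "{i, j}"] by simp
      then show "f i < p \<longleftrightarrow> f j < p" using EV KV by fastforce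
    qed
    show False
    proof (cases "f 0 < p")
      case True
      then have lt: "f i < p" if "i < n" for i using same that by blast
      have "f ` e \<in> E" if e: "e \<in> Tpp_E n" for e
      proof -
        have "0 \<in> e \<or> 1 \<in> e \<or> 2 \<in> e" using e by (cases rule: Tpp_E_cases) auto
        then obtain i where i: "i \<in> e" "i \<le> 2" by force
        then have "f i < p" "f i \<in> f ` e" using lt[of i] n by simp_all
        then have "f ` e \<notin> K" using KV[of "f ` e"] by force
        then show ?thesis using bspec[OF f(3) e] by blast
      qed
      moreover have "f ` Tpp_V n \<subseteq> {0..<p}" using lt by (auto simp: Tpp_V_def)
      ultimately show False using nc f(1) unfolding contains_copy_def by blast
    next
      case False
      then have "f ` Tpp_V n \<subseteq> ?A" using same f(2) by (fastforce simp: Tpp_V_def)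
      then have "card (Tpp_V n) \<le> card ?A" using f(1) by (intro card_inj_on_le) auto
      then show False using n by (simp add: Tpp_V_def)
    qed
  qed
  ultimately show ?thesis unfolding admissible_def by blast
qed

lemma admissible_add_cliques:
  assumes "10 \<le> n" "admissible n p q"
  shows "admissible n (k * (n - 1) + p) (k * ((n - 1) choose 2) + q)"
proof (induction k)
  case (Suc k)
  have "k * (n - 1) + p + (n - 1) = Suc k * (n - 1) + p"
    "k * ((n - 1) choose 2) + q + ((n - 1) choose 2) = Suc k * ((n - 1) choose 2) + q" by simp_all
  then show ?case using admissible_add_clique[OF assms(1) Suc] by (simp only:)
qed (use assms in simp)

text \<open>A circulant graph with offsets \<open>1, \<dots>, D div 2\<close>; for odd \<open>D\<close> a maximum matching with
  offset \<open>N div 2\<close> is added.\<close>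

lemma exists_near_regular:
  assumes "D < N"
  shows "\<exists>E. simple_graph {0..<N} E \<and> card E = (D * N) div 2 \<and>
    (\<forall>u. card {w. {u, w} \<in> E} \<le> D)"
proof -
  define t h where "t = D div 2" and "h = N div 2"
  \<comment> \<open>Addition modulo \<open>N\<close>, as a case distinction that linear arithmetic
    can handle.\<close>
  define step where "step i a = (if i + a < N then i + a else i + a - N)" for i a
  define R where "R = (if odd D then {0..<h} \<times> {h} else {})"
  define P where "P = {0..<N} \<times> {1..t} \<union> R"
  define edge where "edge = (\<lambda>(i, a). {i, step i a})"
  have th: "2 * t < N" "odd D \<Longrightarrow> t < h" "2 * h \<le> N" using assms unfolding t_def h_def by presburger+
  have P: "i < N \<and> 1 \<le> a \<and> 2 * a \<le> N \<and> (2 * a = N \<longrightarrow> i < a \<and> a = h)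
      \<and> (a \<le> t \<or> odd D \<and> a = h \<and> i < h)"
    if "(i, a) \<in> P" for i a
    using that th unfolding P_def R_def by (auto split: if_splits)
  \<comment> \<open>Seen from its other end, an edge of offset \<open>a\<close> has offset
    \<open>N - a\<close>. As \<open>2 * a \<le> N\<close>, confusion is possible only at
    \<open>2 * a = N\<close>, and there the start is restricted to \<open>i < h\<close>.\<close>
  have inj: "inj_on edge P"
  proof (rule inj_onI, clarify)
    fix i a j b assume ia: "(i, a) \<in> P" and jb: "(j, b) \<in> P" and eq: "edge (i, a) = edge (j, b)"
    have "i = j \<and> step i a = step j b \<or> i = step j b \<and> step i a = j"
      using eq unfolding edge_def by (auto simp: doubleton_eq_iff)
    then show "i = j \<and> a = b"
      using P[OF ia] P[OF jb] unfolding step_def by (auto split: if_splits)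
  qed
  have cR: "card R = (if odd D then h else 0)" "finite R" by (auto simp: R_def)
  have "({0..<N} \<times> {1..t}) \<inter> R = {}" using th by (auto simp: R_def)
  then have "card P = N * t + (if odd D then h else 0)"
    unfolding P_def using cR by (simp add: card_Un_disjoint)
  also have "\<dots> = (D * N) div 2"
  proof (cases "odd D")
    case True
    then have "D = 2 * t + 1" by (simp add: t_def)
    then have "D * N = N + 2 * (N * t)" by (simp add: algebra_simps)
    then have "(D * N) div 2 = N * t + h" unfolding h_def by simp
    then show ?thesis using True by simp
  next
    case False
    then have "D = 2 * t" by (simp add: t_def)
    then have "D * N = 2 * (N * t)" by (simp add: mult.assoc mult.commute)
    then have "(D * N) div 2 = N * t" by (simp only: nonzero_mult_div_cancel_left)
    then show ?thesis using False by (simp only: if_False add_0_right)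
  qed
  finally have card: "card (edge ` P) = (D * N) div 2" using card_image[OF inj] by simp
  have sg: "simple_graph {0..<N} (edge ` P)"
  proof -
    have "\<exists>u v. u \<in> {0..<N} \<and> v \<in> {0..<N} \<and> u \<noteq> v \<and> edge (i, a) = {u, v}"
      if "(i, a) \<in> P" for i a
      using P[OF that] by (intro exI[of _ i] exI[of _ "step i a"]) (auto simp: edge_def step_def)
    then show ?thesis unfolding simple_graph_def by auto
  qed
  have "card {w. {u, w} \<in> edge ` P} \<le> D" for u
  proof -
    \<comment> \<open>The possible partner in the matching; the other neighbours of \<open>u\<close>
      lie \<open>a\<close> steps ahead or, as \<open>N - a\<close> steps ahead, \<open>a\<close>
      steps behind.\<close>
    let ?X = "if odd D then {if u < h then u + h else u - h} else {}"
    have "{w. {u, w} \<in> edge ` P}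
        \<subseteq> step u ` {1..t} \<union> (\<lambda>a. step u (N - a)) ` {1..t} \<union> ?X"
    proof
      fix w assume "w \<in> {w. {u, w} \<in> edge ` P}"
      then obtain i a where ia: "(i, a) \<in> P" "{u, w} = {i, step i a}"
        by (auto simp: edge_def)
      then consider "u = i" "w = step i a" | "w = i" "u = step i a"
        by (auto simp: doubleton_eq_iff)
      then show "w \<in> step u ` {1..t} \<union> (\<lambda>a. step u (N - a)) ` {1..t} \<union> ?X"
      proof cases
        case 1
        then show ?thesis using P[OF ia(1)] by (auto simp: step_def)
      next
        case 2
        show ?thesis
        proof (cases "a \<le> t")
          case True
          have "w = step u (N - a)" using 2 P[OF ia(1)] by (auto simp: step_def)
          moreover have "a \<in> {1..t}" using True P[OF ia(1)] by simp
          ultimately show ?thesis by blast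
        next
          case False
          then have "odd D" "a = h" "i < h" using P[OF ia(1)] by auto
          then have "u = w + h" using 2 th(3) by (simp add: step_def)
          then show ?thesis using \<open>odd D\<close> by simp
        qed
      qed
    qed
    then have "card {w. {u, w} \<in> edge ` P}
        \<le> card (step u ` {1..t} \<union> (\<lambda>a. step u (N - a)) ` {1..t} \<union> ?X)"
      by (intro card_mono) auto
    also have "\<dots> \<le> card (step u ` {1..t}) + card ((\<lambda>a. step u (N - a)) ` {1..t}) + card ?X"
      by (meson card_Un_le add_mono le_trans order_refl)
    also have "\<dots> \<le> t + t + (if odd D then 1 else 0)"
      by (intro add_mono order_trans[OF card_image_le]) auto
    also have "\<dots> = D" unfolding t_def by presburger
    finally show ?thesis .
  qed
  then show ?thesis using sg card by blast
qed

text \<open>The centre of a copy would need \<open>n - 4\<close> neighbours.\<close>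

lemma admissible_regular:
  assumes n: "10 \<le> n" and N: "n - 1 \<le> N"
  shows "admissible n N (((n - 5) * N) div 2)"
proof -
  have "n - 5 < N" using n N by linarith
  then obtain E where E: "simple_graph {0..<N} E" "card E = ((n - 5) * N) div 2"
    "\<And>u. card {w. {u, w} \<in> E} \<le> n - 5"
    using exists_near_regular[of "n - 5" N] by blast
  have "\<not> contains_copy {0..<N} E (Tpp_V n) (Tpp_E n)"
  proof
    assume "contains_copy {0..<N} E (Tpp_V n) (Tpp_E n)"
    then obtain f where f: "inj_on f (Tpp_V n)" "\<And>e. e \<in> Tpp_E n \<Longrightarrow> f ` e \<in> E"
      unfolding contains_copy_def by blast
    interpret sgraph "{0..<N}" E by unfold_locales (rule E(1))
    have "f ` {1..n - 4} \<subseteq> nb (f 0)"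
    proof
      fix w assume "w \<in> f ` {1..n - 4}"
      then obtain i where i: "i \<in> {1..n - 4}" "w = f i" by blast
      then have "{0, i} \<in> Tpp_E n" unfolding Tpp_E_def by auto
      then show "w \<in> nb (f 0)" using f(2)[of "{0, i}"] i by (simp add: nb_def)
    qed
    then have "card (f ` {1..n - 4}) \<le> card (nb (f 0))" by (intro card_mono) auto
    moreover have "inj_on f {1..n - 4}"
      by (rule inj_on_subset[OF f(1)]) (use n in \<open>auto simp: Tpp_V_def\<close>)
    then have "card (f ` {1..n - 4}) = n - 4" by (simp add: card_image)
    ultimately show False using E(3)[of "f 0"] n unfolding nb_def by linarith
  qed
  then show ?thesis unfolding admissible_def using E by blast
qed

section \<open>The value of the extremal number\<close>

lemma pronic_choose: "a * (a - 1) = 2 * (a choose 2)" for a :: nat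
proof -
  have "even (a * (a - 1))" by (cases a) auto
  then show ?thesis by (simp add: choose_two)
qed

lemma admissible_le:
  assumes n: "10 \<le> n" and k: "1 \<le> k" and r: "r \<le> n - 2"
    and ad: "admissible n (k * (n - 1) + r) q"
  shows "q \<le> max (k * ((n - 1) choose 2) + (r choose 2))
    ((k - 1) * ((n - 1) choose 2) + ((n - 5) * (n - 1 + r)) div 2)"
proof -
  let ?p = "k * (n - 1) + r" and ?m = "n - 1"
  obtain E where E: "simple_graph {0..<?p} E"
    "\<not> contains_copy {0..<?p} E (Tpp_V n) (Tpp_E n)" "card E = q"
    using ad unfolding admissible_def by blast
  have "bounded_by ?m (card {0..<?p}) (2 * card E)"
    by (intro spider_free_edges spider_free_if_no_copy n E)
  then have "bounded_by ?m ?p (2 * q)" using E(3) by simp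
  then obtain l s where ls: "?p = l * ?m + s" "s < ?m"
    "2 * q \<le> l * (?m * (?m - 1)) + s * (s - 1) \<or>
      1 \<le> l \<and> 2 * q \<le> (l - 1) * (?m * (?m - 1)) + (?m - 4) * (?m + s)"
    unfolding bounded_by_def by blast
  have "r < ?m" using r n by linarith
  \<comment> \<open>The existential numbers in \<open>bounded_by\<close> are the quotient and
    remainder modulo \<open>n - 1\<close>, hence unique.\<close>
  have "l = k"
    using arg_cong[OF ls(1), of "\<lambda>x. x div ?m"] \<open>r < ?m\<close> ls(2) by simp
  then have "s = r" using ls(1) by simp
  have m4: "?m - 4 = n - 5" by simp
  show ?thesis using ls(3) unfolding \<open>l = k\<close> \<open>s = r\<close> pronic_choose m4
    by (auto simp: le_max_iff_disj)
qed

lemma ex_Tpp: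
  assumes n: "10 \<le> n" and k: "1 \<le> k" and r: "r \<le> n - 2"
  shows "ex (k * (n - 1) + r) (Tpp_V n) (Tpp_E n)
    = max (k * ((n - 1) choose 2) + (r choose 2))
      ((k - 1) * ((n - 1) choose 2) + ((n - 5) * (n - 1 + r)) div 2)"
    (is "ex ?p _ _ = max ?a ?b")
proof -
  have "{card E | E. simple_graph {0..<?p} E \<and> \<not> contains_copy {0..<?p} E (Tpp_V n) (Tpp_E n)}
      = {q. admissible n ?p q}" (is "?S = _")
    unfolding admissible_def by blast
  moreover have "Max {q. admissible n ?p q} = max ?a ?b"
  proof (rule Max_eqI)
    show le: "q \<le> max ?a ?b" if "q \<in> {q. admissible n ?p q}" for q
      using admissible_le[OF n k r] that by blast
    show "finite {q. admissible n ?p q}" using le by (meson finite_nat_set_iff_bounded_le)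
    have "admissible n ?p ?a"
      using admissible_add_cliques[OF n admissible_clique[of r n], of k] r n by simp
    moreover have "(k - 1) * (n - 1) + (n - 1 + r) = ?p" using k by (cases k) auto
    then have "admissible n ?p ?b"
      using admissible_add_cliques[OF n admissible_regular[OF n, of "n - 1 + r"], of "k - 1"]
      by (simp only: le_add1)
    ultimately show "max ?a ?b \<in> {q. admissible n ?p q}" by (simp add: max_def)
  qed
  ultimately show ?thesis unfolding ex_def by simp
qed

theorem theorem3p1:
  fixes p n k r :: nat
  assumes "n \<ge> 10" and "p \<ge> n" and "k \<ge> 1" and "r \<le> n - 2"
    and "p = k * (n - 1) + r"
  shows "real (ex p (Tpp_V n) (Tpp_E n)) =
           (real (n - 2) * real p - real r * (real n - 1 - real r)) / 2
           + max 0 (real_of_int \<lfloor>(real r * (real n - 4 - real r) - 3 * (real n - 1)) / 2\<rfloor>)"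
proof -
  let ?a = "k * ((n - 1) choose 2) + (r choose 2)"
  let ?b = "(k - 1) * ((n - 1) choose 2) + ((n - 5) * (n - 1 + r)) div 2"
  \<comment> \<open>This is \<open>(n - 5) * (n - 1 + r) - (n - 1) * (n - 2) - r * (r - 1)\<close>,
    twice the gap between the two extremal sizes before rounding. It does not depend on
    \<open>k\<close>, and the part subtracted is even, so halving with rounding commutes with the
    subtraction.\<close>
  define z where "z = int r * (int n - 4 - int r) - 3 * (int n - 1)"
  have pr: "2 * int (a choose 2) = int a * (int a - 1)" for a
    using arg_cong[OF pronic_choose[of a], of int] by (cases a) (auto simp: algebra_simps)
  have n1: "int (n - 1) = int n - 1" "int (n - 5) = int n - 5" "int (n - 2) = int n - 2"
    using assms(1) by auto
  have a: "2 * int ?a = int (n - 2) * int p - int r * (int n - 1 - int r)"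
  proof -
    have "2 * int ?a = int k * (2 * int ((n - 1) choose 2)) + 2 * int (r choose 2)" by simp
    also have "\<dots> = int (n - 2) * int p - int r * (int n - 1 - int r)"
      unfolding pr assms(5) of_nat_add of_nat_mult n1 by (simp add: algebra_simps)
    finally show ?thesis .
  qed
  have b: "int ?b = int ?a + z div 2"
  proof -
    have "int ((n - 5) * (n - 1 + r)) = z + 2 * (int ((n - 1) choose 2) + int (r choose 2))"
      using pr[of "n - 1"] pr[of r] unfolding z_def of_nat_add of_nat_mult n1
      by (simp add: algebra_simps)
    then have "int (((n - 5) * (n - 1 + r)) div 2)
        = z div 2 + (int ((n - 1) choose 2) + int (r choose 2))"
      by (simp add: zdiv_int)
    moreover have "k * ((n - 1) choose 2) = (k - 1) * ((n - 1) choose 2) + ((n - 1) choose 2)"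
      using assms(3) by (cases k) auto
    ultimately show ?thesis by linarith
  qed
  have fl: "\<lfloor>(real r * (real n - 4 - real r) - 3 * (real n - 1)) / 2\<rfloor> = z div 2"
  proof -
    have "(real r * (real n - 4 - real r) - 3 * (real n - 1)) / 2 = real_of_int z / real_of_int 2"
      by (simp add: z_def)
    then show ?thesis by (simp only: floor_divide_of_int_eq)
  qed
  have "int (max ?a ?b) = int ?a + max 0 (z div 2)" using b by linarith
  then have "real_of_int (int (max ?a ?b)) = real_of_int (int ?a + max 0 (z div 2))"
    by (simp only:)
  then have 1: "real (max ?a ?b) = real_of_int (int ?a) + max 0 (real_of_int (z div 2))"
    by (simp only: of_int_add of_int_of_nat_eq of_int_max of_int_0)
  have "real_of_int (2 * int ?a) = real_of_int (int (n - 2) * int p - int r * (int n - 1 - int r))"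
    by (simp only: a)
  then have 2: "2 * real_of_int (int ?a) = real (n - 2) * real p - real r * (real n - 1 - real r)"
    by (simp only: of_int_mult of_int_diff of_int_of_nat_eq of_int_numeral of_int_1)
  have ex: "ex p (Tpp_V n) (Tpp_E n) = max ?a ?b"
    by (simp only: assms(5) ex_Tpp[OF assms(1,3,4)])
  show ?thesis unfolding ex fl 1 2[symmetric] by simp
qed

end
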